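(* For every triangle $K \subset \mathbb{R}^2$, $$\theta(K) - \Delta(K) \ge \frac{7}{240}\,|\sigma K|,$$ where $|\sigma K|$ is the perimeter of $K$.
   Context: A triangle means a non-degenerate (full-dimensional) closed triangle. $\Delta(K) = \mathbb{E}|XX'|$, where $X, X'$ are independent and uniformly distributed in $K$ with respect to Lebesgue measure; $\theta(K) = \mathbb{E}|YY'|$, where $Y, Y'$ are independent and uniformly distributed on $\partial K$ with respect to arc length. $|AB|$ denotes Euclidean distance. *)

theory Defs
  imports "HOL-Analysis.Analysis"
begin

text \<open>
  The push-forward under \<open>g\<close> of the measure \<open>|g'(t)| dt\<close> on \<open>[0,1]\<close>. For a simple path this is
  the arc-length measure carried by the image of \<open>g\<close>.
\<close>

definition path_arc_length :: "(real \<Rightarrow> 'a::euclidean_space) \<Rightarrow> 'a measure" where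
  "path_arc_length g =
     distr (density (restrict_space lborel {0..1})
              (\<lambda>t. ennreal (norm (vector_derivative g (at t))))) borel g"

definition jordan_param :: "(real \<Rightarrow> 'a::euclidean_space) \<Rightarrow> 'a set \<Rightarrow> bool" where
  "jordan_param g C \<longleftrightarrow>
     valid_path g \<and> simple_path g \<and> pathfinish g = pathstart g \<and> path_image g = C"

text \<open>
  Arc length on a piecewise \<open>C\<^sup>1\<close> Jordan curve, as a measure depending only on the point set:
  for such a curve, the measure does not depend on the choice of the parametrization. The
  definition is meaningless for other sets; for the boundary of a triangle a parametrization
  exists by the lemma \<open>jordan_param_triangle\<close> below.
\<close>

definition arc_length :: "'a::euclidean_space set \<Rightarrow> 'a measure" where
  "arc_length C = path_arc_length (SOME g. jordan_param g C)"

definition perimeter :: "(real^2) set \<Rightarrow> real" where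
  "perimeter K = measure (arc_length (frontier K)) (frontier K)"

definition mean_distance :: "'a::metric_space measure \<Rightarrow> real" where
  "mean_distance M = (LINT p | (M \<Otimes>\<^sub>M M). dist (fst p) (snd p))"

definition Delta :: "(real^2) set \<Rightarrow> real" where
  "Delta K = mean_distance (uniform_measure lborel K)"

definition theta :: "(real^2) set \<Rightarrow> real" where
  "theta K = mean_distance (uniform_measure (arc_length (frontier K)) (frontier K))"

definition triangle :: "(real^2) set \<Rightarrow> bool" where
  "triangle K \<longleftrightarrow> (\<exists>a b c. \<not> collinear {a, b, c} \<and> K = convex hull {a, b, c})"

lemma jordan_param_triangle:
  assumes "triangle K"
  shows "\<exists>g. jordan_param g (frontier K)"
proof -
  from assms obtain a b c where nc: "\<not> collinear {a, b, c}" and K: "K = convex hull {a, b, c}"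
    unfolding triangle_def by blast
  let ?g = "linepath a b +++ (linepath b c +++ linepath c a)"
  have neq: "a \<noteq> b" "b \<noteq> c" "c \<noteq> a"
    using nc by (auto simp: insert_commute)
  have ab: "closed_segment a b \<inter> closed_segment b c = {b}"
    and bc: "closed_segment b c \<inter> closed_segment c a = {c}"
    and ca: "closed_segment c a \<inter> closed_segment a b = {a}"
    using nc by (auto intro!: Int_closed_segment simp: insert_commute)
  have "arc (linepath b c +++ linepath c a)"
    using neq bc by (intro arc_join) auto
  then have "simple_path ?g"
    using neq ab ca by (intro simple_path_join_loop) (auto simp: path_image_join)
  moreover have "valid_path ?g"
    by (intro valid_path_join) auto
  moreover have "path_image ?g = frontier K"
    using frontier_of_triangle[of a b c] by (simp add: K path_image_join Un_assoc)
  ultimately show ?thesis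
    by (auto simp: jordan_param_def)
qed

end

(*
Let L be the perimeter. The difference is at least L / 30, because Delta K <= 2 L / 15 and
theta K >= L / 6.

Delta: the difference of two points of K is p A + q B + r C with p + q + r = 0, where p, q, r are the
differences of the barycentric coordinates. Its norm is at most a linear combination of |p|, |q|, |r|
whose coefficients (differences of L / 2 and a side) sum to L / 2. A barycentric coordinate of a
uniform point exceeds t with probability (1 - t)^2, so its mean absolute difference is
2 int (1 - t)^2 (1 - (1 - t)^2) dt = 4 / 15.

theta: two points on one side have mean distance a third of the side. For two points on different
sides, homogeneity expresses the mean distance through the mean distances from a vertex to the
opposite side. Bounding the latter from below by concavity of the square root turns the claim into a
polynomial identity in the side lengths. The bound is an equality for degenerate triangles.

Arc length does not depend on the parametrization: on the parameters mapped into one edge, the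
coordinate along the edge is an injective change of variables.
*)

theory Submission
  imports Defs "HOL-Probability.Probability_Measure"
begin

section \<open>Arc length on the boundary of a triangle\<close>

text \<open>The arc-length integral of \<open>f\<close> along the segment: \<open>dist p q\<close>
  is the speed of the affine parametrization. Nesting two of these gives the double integral of the
  distance over a pair of sides.\<close>

definition segment_integral :: "'a::euclidean_space \<Rightarrow> 'a \<Rightarrow> ('a \<Rightarrow> real) \<Rightarrow> real" where
  "segment_integral p q f = dist p q * integral {0..1} (\<lambda>t. f (p + t *\<^sub>R (q - p)))"

text \<open>Followed by the affine coordinate along the segment, \<open>g\<close> becomes an
  injective real function, to which the one-dimensional change of variables applies.
  \<open>T\<close> is an arbitrary open set, since a closed curve may run through an edge in two
  pieces, around its starting point.\<close>

lemma segment_integral_change_of_variables: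
  fixes g D :: "real \<Rightarrow> 'a::euclidean_space" and f :: "'a \<Rightarrow> real"
  assumes "open T" and inj: "inj_on g T"
    and der: "\<And>t. t \<in> T \<Longrightarrow> (g has_vector_derivative D t) (at t)"
    and sub: "g ` T \<subseteq> closed_segment p q" and fin: "finite (closed_segment p q - g ` T)"
    and "p \<noteq> q" and f: "continuous_on UNIV f"
  shows "(\<lambda>t. norm (D t) * f (g t)) absolutely_integrable_on T"
    and "integral T (\<lambda>t. norm (D t) * f (g t)) = segment_integral p q f"
proof -
  \<comment> \<open>Orthogonal projection onto the line through \<open>p\<close> and
    \<open>q\<close>, scaled to send \<open>p\<close> to 0 and \<open>q\<close> to 1.\<close>
  define \<phi> where "\<phi> x = ((x - p) \<bullet> (q - p)) / (norm (q - p))\<^sup>2" for x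
  define h where "h s = f (p + s *\<^sub>R (q - p))" for s
  have npq: "norm (q - p) > 0" using \<open>p \<noteq> q\<close> by simp
  have \<phi>_seg: "\<phi> (p + s *\<^sub>R (q - p)) = s" for s
    using npq by (simp add: \<phi>_def power2_norm_eq_inner)
  have seg: "x = p + \<phi> x *\<^sub>R (q - p) \<and> \<phi> x \<in> {0..1}" if x: "x \<in> closed_segment p q" for x
  proof -
    obtain u where u: "0 \<le> u" "u \<le> 1" "x = p + u *\<^sub>R (q - p)"
      using x by (auto simp: in_segment algebra_simps)
    then show ?thesis using \<phi>_seg[of u] by simp
  qed
  have inj\<phi>: "inj_on \<phi> (closed_segment p q)"
    by (metis inj_onI seg)
  have \<phi>cs: "\<phi> ` closed_segment p q = {0..1}"
  proof
    show "{0..1} \<subseteq> \<phi> ` closed_segment p q"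
    proof
      fix s :: real assume "s \<in> {0..1}"
      then have "p + s *\<^sub>R (q - p) \<in> closed_segment p q"
        by (auto simp: in_segment algebra_simps intro!: exI[of _ s])
      then show "s \<in> \<phi> ` closed_segment p q" by (metis \<phi>_seg image_eqI)
    qed
  qed (use seg in auto)
  have der\<phi>: "((\<lambda>t. \<phi> (g t)) has_field_derivative (D t \<bullet> (q - p) / (norm (q - p))\<^sup>2)) (at t)"
    if "t \<in> T" for t
  proof -
    have "((\<lambda>t. (g t - p) \<bullet> (q - p)) has_vector_derivative D t \<bullet> (q - p)) (at t)"
      using has_vector_derivative_diff_const[of g p] der[OF that]
      by (intro bounded_linear.has_vector_derivative[OF bounded_linear_inner_left]) simp
    then show ?thesis
      unfolding \<phi>_def by (intro DERIV_cdivide) (simp add: has_real_derivative_iff_has_vector_derivative)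
  qed
  \<comment> \<open>On \<open>T\<close> the curve stays on the line, so its velocity is a multiple
    of \<open>q - p\<close>; the scalar is the derivative of the coordinate.\<close>
  have normD: "norm (D t) = norm (q - p) * \<bar>D t \<bullet> (q - p) / (norm (q - p))\<^sup>2\<bar>" if t: "t \<in> T" for t
  proof -
    have "((\<lambda>t. p + \<phi> (g t) *\<^sub>R (q - p)) has_vector_derivative
             (D t \<bullet> (q - p) / (norm (q - p))\<^sup>2) *\<^sub>R (q - p)) (at t)"
      using has_vector_derivative_add[OF has_vector_derivative_const
          has_vector_derivative_scaleR[OF der\<phi>[OF t] has_vector_derivative_const]] by simp
    moreover have "p + \<phi> (g x) *\<^sub>R (q - p) = g x" if "x \<in> T" for x
      using seg[of "g x"] sub that by force
    ultimately have "(g has_vector_derivative (D t \<bullet> (q - p) / (norm (q - p))\<^sup>2) *\<^sub>R (q - p)) (at t)"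
      using has_vector_derivative_transform_within_open \<open>open T\<close> t by blast
    then have "D t = (D t \<bullet> (q - p) / (norm (q - p))\<^sup>2) *\<^sub>R (q - p)"
      using der[OF t] vector_derivative_unique_at by blast
    then show ?thesis by (metis norm_scaleR mult.commute)
  qed
  have inj': "inj_on (\<lambda>t. \<phi> (g t)) T"
    using comp_inj_on[OF inj] inj_on_subset[OF inj\<phi> sub] by (simp add: o_def)
  have h: "continuous_on UNIV h"
    unfolding h_def by (intro continuous_on_compose2[OF f] continuous_intros) auto
  have habs: "h absolutely_integrable_on {0..1}"
    using absolutely_integrable_continuous_real continuous_on_subset[OF h] by blast
  \<comment> \<open>Parameters missed by the coordinate come from points of the segment missed by
    \<open>g\<close>, so they form a finite and hence negligible set.\<close>
  have "{0..1} - (\<lambda>t. \<phi> (g t)) ` T \<subseteq> \<phi> ` (closed_segment p q - g ` T)"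
    unfolding \<phi>cs[symmetric] by auto
  then have "finite ({0..1} - (\<lambda>t. \<phi> (g t)) ` T)"
    using fin finite_subset by blast
  moreover have "(\<lambda>t. \<phi> (g t)) ` T \<subseteq> {0..1}"
    using sub \<phi>cs by auto
  ultimately have neg: "negligible (sym_diff {0..1} ((\<lambda>t. \<phi> (g t)) ` T))"
    by (metis Diff_eq_empty_iff negligible_finite sup_bot.right_neutral)
  have neg': "negligible {s \<in> {0..1} - (\<lambda>t. \<phi> (g t)) ` T. h s \<noteq> 0}"
    "negligible {s \<in> (\<lambda>t. \<phi> (g t)) ` T - {0..1}. h s \<noteq> 0}"
    by (rule negligible_subset[OF neg], blast)+
  have "h absolutely_integrable_on (\<lambda>t. \<phi> (g t)) ` T \<and>
      integral ((\<lambda>t. \<phi> (g t)) ` T) h = integral {0..1} h"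
    using absolutely_integrable_spike_set[OF habs neg'] integral_spike_set[OF neg'] by simp
  then have "(\<lambda>t. \<bar>D t \<bullet> (q - p) / (norm (q - p))\<^sup>2\<bar> * h (\<phi> (g t))) absolutely_integrable_on T \<and>
      integral T (\<lambda>t. \<bar>D t \<bullet> (q - p) / (norm (q - p))\<^sup>2\<bar> * h (\<phi> (g t))) = integral {0..1} h"
    using has_absolute_integral_change_of_variables_1'[OF _ _ inj',
        of "\<lambda>t. D t \<bullet> (q - p) / (norm (q - p))\<^sup>2" h "integral {0..1} h"] der\<phi> \<open>open T\<close>
    by (simp add: has_field_derivative_at_within borel_open lebesgue_openin)
  then have *: "(\<lambda>t. norm (q - p) * (\<bar>D t \<bullet> (q - p) / (norm (q - p))\<^sup>2\<bar> * h (\<phi> (g t)))) absolutely_integrable_on T"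
    and **: "integral T (\<lambda>t. norm (q - p) * (\<bar>D t \<bullet> (q - p) / (norm (q - p))\<^sup>2\<bar> * h (\<phi> (g t)))) =
      norm (q - p) * integral {0..1} h"
    by (auto intro!: set_integrable_mult_right simp only: integral_mult_right)
  have eq: "norm (q - p) * (\<bar>D t \<bullet> (q - p) / (norm (q - p))\<^sup>2\<bar> * h (\<phi> (g t))) = norm (D t) * f (g t)"
    if "t \<in> T" for t
  proof -
    have "h (\<phi> (g t)) = f (g t)"
      using seg[of "g t"] sub that unfolding h_def by force
    then show ?thesis using normD[OF that] by simp
  qed
  show "(\<lambda>t. norm (D t) * f (g t)) absolutely_integrable_on T"
    using * by (rule set_integrable_cong[THEN iffD1, rotated -1]) (simp_all only: eq)
  have "integral T (\<lambda>t. norm (D t) * f (g t)) =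
      integral T (\<lambda>t. norm (q - p) * (\<bar>D t \<bullet> (q - p) / (norm (q - p))\<^sup>2\<bar> * h (\<phi> (g t))))"
    by (rule integral_cong) (simp only: eq)
  also have "\<dots> = segment_integral p q f"
    using ** by (simp add: segment_integral_def h_def[abs_def] dist_norm norm_minus_commute)
  finally show "integral T (\<lambda>t. norm (D t) * f (g t)) = segment_integral p q f" .
qed

text \<open>Discarding finitely many parameters leaves an open set that splits into three open
  pieces, one per edge. The change of variables on each piece yields an expression free of
  \<open>g\<close>, so the choice made in \<open>arc_length\<close> is harmless.\<close>

lemma path_arc_length_triangle:
  fixes a b c :: "'a::euclidean_space"
  assumes nc: "\<not> collinear {a, b, c}"
    and g: "jordan_param g (closed_segment a b \<union> closed_segment b c \<union> closed_segment c a)"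
  shows "finite_measure (path_arc_length g)"
    and "AE x in path_arc_length g. x \<in> closed_segment a b \<union> closed_segment b c \<union> closed_segment c a"
    and "continuous_on UNIV f \<Longrightarrow> integral\<^sup>L (path_arc_length g) f =
      segment_integral a b f + segment_integral b c f + segment_integral c a f"
proof -
  let ?F = "closed_segment a b \<union> closed_segment b c \<union> closed_segment c a"
  let ?w = "\<lambda>t. norm (vector_derivative g (at t))"
  have neq: "a \<noteq> b" "b \<noteq> c" "c \<noteq> a"
    using nc by (auto simp: insert_commute)
  have int: "closed_segment a b \<inter> closed_segment b c = {b}"
    "closed_segment b c \<inter> closed_segment c a = {c}"
    "closed_segment c a \<inter> closed_segment a b = {a}"
    using nc by (auto intro!: Int_closed_segment simp: insert_commute)
  have cont: "continuous_on {0..1} g" and loop: "loop_free g" and im: "g ` {0..1} = ?F"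
    using g by (auto simp: jordan_param_def simple_path_def path_def path_image_def)
  obtain S D where "finite S" and der: "\<And>t. t \<in> {0..1} - S \<Longrightarrow> (g has_vector_derivative D t) (at t)"
    and contD: "continuous_on ({0..1} - S) D"
    using g unfolding jordan_param_def valid_path_def piecewise_C1_differentiable_on_def
      C1_differentiable_on_def by blast
  \<comment> \<open>Besides the points where \<open>g\<close> may fail to be differentiable, the
    endpoints and the parameters of the vertices are dropped; injectivity keeps this set finite. At
    all other parameters \<open>g t\<close> lies on exactly one edge.\<close>
  define S' where "S' = S \<union> {0, 1} \<union> {t \<in> {0<..<1}. g t \<in> {a, b, c}}"
  have inj: "inj_on g {0<..<1}"
    using loop unfolding loop_free_def inj_on_def
    by (metis greaterThanLessThan_iff less_eq_real_def less_irrefl atLeastAtMost_iff)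
  have "finite (g -` {a, b, c} \<inter> {0<..<1})"
    using inj by (intro finite_vimage_IntI) auto
  then have fin: "finite S'"
    unfolding S'_def using \<open>finite S\<close> by (auto simp: vimage_def Int_def conj_commute)
  define T where "T = {0<..<1} - S'"
  have opT: "open T"
    unfolding T_def using fin by (simp add: open_Diff finite_imp_closed)
  have Teq: "T = {0..1} - S'"
    unfolding T_def S'_def by auto
  have TS: "T \<subseteq> {0..1} - S" unfolding Teq S'_def by auto
  have injT: "inj_on g T" using inj unfolding T_def by (rule inj_on_subset) auto
  have contT: "continuous_on T g" using cont by (rule continuous_on_subset) (auto simp: Teq)
  have Tvert: "g t \<notin> {a, b, c}" "g t \<in> ?F" if "t \<in> T" for t
    using that im unfolding T_def S'_def by auto
  \<comment> \<open>the parameters at which \<open>g\<close> runs in the interior of the edge \<open>pq\<close>; open, as the other edges are closed\<close>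
  define P where "P p q r = {t \<in> T. g t \<notin> closed_segment q r \<union> closed_segment r p}" for p q r
  have opP: "open (P p q r)" for p q r
  proof -
    have "open (T \<inter> g -` (- (closed_segment q r \<union> closed_segment r p)))"
      by (intro continuous_open_preimage[OF contT opT] open_Compl closed_Un closed_segment)
    then show ?thesis by (simp add: P_def Int_def vimage_def)
  qed
  \<comment> \<open>Stated for a generic edge, so that the three edges follow by cyclic
    rotation.\<close>
  have piece: "(\<lambda>t. norm (D t) * f (g t)) absolutely_integrable_on P p q r \<and>
       integral (P p q r) (\<lambda>t. norm (D t) * f (g t)) = segment_integral p q f"
    if F: "?F = closed_segment p q \<union> closed_segment q r \<union> closed_segment r p"
      and v: "{p, q, r} = {a, b, c}" "p \<noteq> q"
      and i: "closed_segment p q \<inter> closed_segment q r = {q}" "closed_segment r p \<inter> closed_segment p q = {p}"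
      and f: "continuous_on UNIV f" for p q r and f :: "'a \<Rightarrow> real"
  proof -
    have sub: "g ` P p q r \<subseteq> closed_segment p q"
      using Tvert(2) unfolding F P_def by auto
    \<comment> \<open>A point of the edge missed on this piece is the image of a discarded
      parameter: otherwise it would lie on a second edge and be a vertex.\<close>
    have "closed_segment p q - g ` P p q r \<subseteq> g ` S'"
    proof
      fix x assume x: "x \<in> closed_segment p q - g ` P p q r"
      then obtain t where t: "t \<in> {0..1}" "x = g t"
        using im F by (metis DiffD1 UnCI imageE)
      show "x \<in> g ` S'"
      proof (rule ccontr)
        assume "x \<notin> g ` S'"
        then have "t \<in> T" using t Teq by auto
        moreover have "t \<notin> P p q r" using x t by auto
        ultimately have "x \<in> closed_segment q r \<union> closed_segment r p"
          using t unfolding P_def by auto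
        then have "x \<in> {p, q, r}" using x i by auto
        then show False using Tvert(1)[OF \<open>t \<in> T\<close>] v t by auto
      qed
    qed
    then have fin': "finite (closed_segment p q - g ` P p q r)"
      using fin finite_subset by blast
    have PT: "P p q r \<subseteq> T" unfolding P_def by auto
    show ?thesis
      using segment_integral_change_of_variables[OF opP inj_on_subset[OF injT PT] _ sub fin' v(2) f, of D]
        der PT TS by blast
  qed
  have one: "\<not> (g t \<in> closed_segment a b \<and> g t \<in> closed_segment b c)"
    "\<not> (g t \<in> closed_segment b c \<and> g t \<in> closed_segment c a)"
    "\<not> (g t \<in> closed_segment c a \<and> g t \<in> closed_segment a b)" if "t \<in> T" for t
    using int Tvert(1)[OF that] by (metis IntI insertCI singletonD)+
  have TP: "T = P a b c \<union> P b c a \<union> P c a b"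
    using Tvert(2) one unfolding P_def by auto
  have disj: "P a b c \<inter> P b c a = {}" "(P a b c \<union> P b c a) \<inter> P c a b = {}"
    using Tvert unfolding P_def by auto
  have main: "(\<lambda>t. ?w t * f (g t)) absolutely_integrable_on {0..1} \<and>
      integral {0..1} (\<lambda>t. ?w t * f (g t)) =
        segment_integral a b f + segment_integral b c f + segment_integral c a f"
    if f: "continuous_on UNIV f" for f :: "'a \<Rightarrow> real"
  proof -
    let ?h = "\<lambda>t. norm (D t) * f (g t)"
    have 1: "?h absolutely_integrable_on P a b c" "integral (P a b c) ?h = segment_integral a b f"
      using piece[of a b c, OF _ _ _ _ _ f] neq int by (auto simp: insert_commute)
    have 2: "?h absolutely_integrable_on P b c a" "integral (P b c a) ?h = segment_integral b c f"
      using piece[of b c a, OF _ _ _ _ _ f] neq int by (auto simp: insert_commute)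
    have 3: "?h absolutely_integrable_on P c a b" "integral (P c a b) ?h = segment_integral c a f"
      using piece[of c a b, OF _ _ _ _ _ f] neq int by (auto simp: insert_commute)
    have "(?h has_integral segment_integral a b f) (P a b c)"
        "(?h has_integral segment_integral b c f) (P b c a)"
        "(?h has_integral segment_integral c a f) (P c a b)"
      using 1 2 3 set_lebesgue_integral_eq_integral(1) by (metis integrable_integral)+
    then have hi: "(?h has_integral segment_integral a b f + segment_integral b c f + segment_integral c a f) T"
      unfolding TP using disj by (intro has_integral_Un) auto
    have ai: "?h absolutely_integrable_on T"
      unfolding TP by (intro absolutely_integrable_Un 1 2 3)
    have hw: "?h t = ?w t * f (g t)" if "t \<in> T" for t
      using vector_derivative_at[OF der, of t] that TS by auto
    have aiT: "(\<lambda>t. ?w t * f (g t)) absolutely_integrable_on T"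
      using ai by (rule set_integrable_cong[THEN iffD1, rotated -1]) (simp_all only: hw)
    have hiT: "((\<lambda>t. ?w t * f (g t)) has_integral
        segment_integral a b f + segment_integral b c f + segment_integral c a f) T"
      using hi by (rule has_integral_eq[rotated]) (simp only: hw)
    have "negligible S'" using fin by (rule negligible_finite)
    then have neg: "negligible {t \<in> T - {0..1}. ?w t * f (g t) \<noteq> 0}" "negligible {t \<in> {0..1} - T. ?w t * f (g t) \<noteq> 0}"
      by (auto intro: negligible_subset simp: Teq)
    show ?thesis
      using absolutely_integrable_spike_set[OF aiT neg] integral_spike_set[OF neg] integral_unique[OF hiT]
      by simp
  qed
  let ?I = "restrict_space lborel {0..1::real}"
  have gm[measurable]: "g \<in> borel_measurable ?I"
    using borel_measurable_continuous_on_restrict[OF cont]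
    by (simp add: measurable_def space_restrict_space sets_restrict_space)
  \<comment> \<open>At the finitely many discarded parameters \<open>vector_derivative\<close> may
    be arbitrary; elsewhere the speed is \<open>norm (D t)\<close>, continuous on the open set
    \<open>T\<close>.\<close>
  have wm[measurable]: "?w \<in> borel_measurable ?I"
  proof (rule measurable_discrete_difference[where X = "S' \<inter> {0..1}"])
    have "continuous_on T (\<lambda>t. norm (D t))"
      using contD TS by (intro continuous_intros) (rule continuous_on_subset)
    then have "(\<lambda>t. indicator T t *\<^sub>R norm (D t)) \<in> borel_measurable borel"
      using opT by (intro borel_measurable_continuous_on_indicator) auto
    then show "(\<lambda>t. indicator T t *\<^sub>R norm (D t)) \<in> borel_measurable ?I"
      by (simp add: measurable_restrict_space1)
    show "\<And>x. x \<in> S' \<inter> {0..1} \<Longrightarrow> {x} \<in> sets ?I"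
      by (auto simp: sets_restrict_space_iff)
    show "indicator T x *\<^sub>R norm (D x) = ?w x" if "x \<in> space ?I" "x \<notin> S' \<inter> {0..1}" for x
    proof -
      have "x \<in> T" using that by (auto simp: Teq space_restrict_space)
      then show ?thesis using vector_derivative_at[OF der, of x] TS by auto
    qed
  qed (use fin in \<open>auto simp: countable_finite\<close>)
  have wf: "integrable ?I (\<lambda>t. ?w t * f (g t)) \<and> integral\<^sup>L ?I (\<lambda>t. ?w t * f (g t)) =
        segment_integral a b f + segment_integral b c f + segment_integral c a f"
    if f: "continuous_on UNIV f" for f :: "'a \<Rightarrow> real"
  proof -
    have [measurable]: "f \<in> borel_measurable borel" using f by (rule borel_measurable_continuous_onI)
    have m: "(\<lambda>t. ?w t * f (g t)) \<in> borel_measurable ?I" by measurable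
    then have m': "(\<lambda>t. indicator {0..1} t *\<^sub>R (?w t * f (g t))) \<in> borel_measurable lborel"
      by (subst (asm) borel_measurable_restrict_space_iff) auto
    have "integrable ?I (\<lambda>t. ?w t * f (g t))"
      using main[OF f] m' by (simp add: integrable_restrict_space set_integrable_def integrable_completion)
    moreover have "integral\<^sup>L ?I (\<lambda>t. ?w t * f (g t)) = integral {0..1} (\<lambda>t. ?w t * f (g t))"
      using main[OF f] m' set_lebesgue_integral_eq_integral(2)[of "{0..1}" "\<lambda>t. ?w t * f (g t)"]
      by (simp add: integral_restrict_space set_lebesgue_integral_def integral_completion)
    ultimately show ?thesis using main[OF f] by simp
  qed
  show "finite_measure (path_arc_length g)"
  proof (rule finite_measureI)
    have "integrable ?I ?w" using wf[of "\<lambda>_. 1"] by simp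
    then have "(\<integral>\<^sup>+t. ennreal (?w t) \<partial>?I) < \<infinity>"
      by (simp add: integrable_iff_bounded)
    moreover have "emeasure (path_arc_length g) (space (path_arc_length g)) =
        (\<integral>\<^sup>+t. ennreal (?w t) \<partial>?I)"
    proof -
      have "emeasure (path_arc_length g) (space (path_arc_length g)) =
          emeasure (density ?I (\<lambda>t. ennreal (?w t))) (space ?I)"
        by (simp add: path_arc_length_def emeasure_distr)
      also have "\<dots> = (\<integral>\<^sup>+t. ennreal (?w t) * indicator (space ?I) t \<partial>?I)"
        by (intro emeasure_density sets.top) measurable
      also have "\<dots> = (\<integral>\<^sup>+t. ennreal (?w t) \<partial>?I)"
        by (intro nn_integral_cong) simp
      finally show ?thesis .
    qed
    ultimately show "emeasure (path_arc_length g) (space (path_arc_length g)) \<noteq> \<infinity>" by simp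
  qed
  show "AE x in path_arc_length g. x \<in> ?F"
    unfolding path_arc_length_def
    by (subst AE_distr_iff) (auto simp: AE_density im[symmetric] space_restrict_space
        intro!: AE_I2 borel_compact compact_continuous_image cont)
  show "integral\<^sup>L (path_arc_length g) f = segment_integral a b f + segment_integral b c f + segment_integral c a f"
    if f: "continuous_on UNIV f"
  proof -
    have [measurable]: "f \<in> borel_measurable borel" using f by (rule borel_measurable_continuous_onI)
    show ?thesis
      using wf[OF f] by (simp add: path_arc_length_def integral_distr integral_density)
  qed
qed

section \<open>Mean distance of boundary points\<close>

lemma has_integral_abs_affine:
  fixes p q :: real
  assumes "0 \<le> p" "0 \<le> q" "0 < p + q"
  shows "((\<lambda>t. \<bar>(1 - t) * p - t * q\<bar>) has_integral (p\<^sup>2 + q\<^sup>2) / (2 * (p + q))) {0..1}"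
proof -
  let ?F = "\<lambda>t. t * p - t\<^sup>2 * (p + q) / 2"
  \<comment> \<open>The zero of the affine function. Its sign changes there, so \<open>?F\<close> is
    an antiderivative to the left and its negative to the right.\<close>
  define \<tau> where "\<tau> = p / (p + q)"
  have \<tau>: "0 \<le> \<tau>" "\<tau> \<le> 1" using assms by (auto simp: \<tau>_def)
  have p: "p = \<tau> * (p + q)" using assms by (simp add: \<tau>_def)
  have d: "(1 - t) * p - t * q = (\<tau> - t) * (p + q)" for t
    using p by (simp add: algebra_simps)
  have "((\<lambda>t. \<bar>(1 - t) * p - t * q\<bar>) has_integral (?F \<tau> - ?F 0)) {0..\<tau>}"
  proof (rule fundamental_theorem_of_calculus[OF \<tau>(1)])
    fix t assume "t \<in> {0..\<tau>}"
    then have "\<bar>(1 - t) * p - t * q\<bar> = (1 - t) * p - t * q"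
      unfolding d using assms by simp
    moreover have "(?F has_real_derivative (1 - t) * p - t * q) (at t within {0..\<tau>})"
      by (auto intro!: derivative_eq_intros simp: algebra_simps)
    ultimately show "(?F has_vector_derivative \<bar>(1 - t) * p - t * q\<bar>) (at t within {0..\<tau>})"
      by (simp add: has_real_derivative_iff_has_vector_derivative)
  qed
  moreover have "((\<lambda>t. \<bar>(1 - t) * p - t * q\<bar>) has_integral (- ?F 1 - (- ?F \<tau>))) {\<tau>..1}"
  proof (rule fundamental_theorem_of_calculus[OF \<tau>(2)])
    fix t assume "t \<in> {\<tau>..1}"
    then have "\<bar>(1 - t) * p - t * q\<bar> = - ((1 - t) * p - t * q)"
      unfolding d using assms by (intro abs_of_nonpos mult_nonpos_nonneg) auto
    moreover have "((\<lambda>t. - ?F t) has_real_derivative - ((1 - t) * p - t * q)) (at t within {\<tau>..1})"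
      by (auto intro!: derivative_eq_intros simp: algebra_simps)
    ultimately show "((\<lambda>t. - ?F t) has_vector_derivative \<bar>(1 - t) * p - t * q\<bar>) (at t within {\<tau>..1})"
      by (simp add: has_real_derivative_iff_has_vector_derivative)
  qed
  ultimately have "((\<lambda>t. \<bar>(1 - t) * p - t * q\<bar>) has_integral (?F \<tau> - ?F 0) + (- ?F 1 - (- ?F \<tau>))) {0..1}"
    by (rule has_integral_combine[OF \<tau>])
  moreover have "(?F \<tau> - ?F 0) + (- ?F 1 - (- ?F \<tau>)) = (p\<^sup>2 + q\<^sup>2) / (2 * (p + q))"
  proof -
    define r where "r = p + q"
    have pq: "p = \<tau> * r" "q = (1 - \<tau>) * r" and "r \<noteq> 0"
      using p assms by (auto simp: r_def algebra_simps)
    then show ?thesis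
      unfolding r_def[symmetric] pq by (simp add: field_simps power2_eq_square)
  qed
  ultimately show ?thesis by simp
qed

text \<open>
  With \<open>A = (1 - t) |x| + t |y|\<close> and \<open>B = |(1 - t) |x| - t |y||\<close>, the squared norm is the convex combination
  \<open>k A\<^sup>2 + (1 - k) B\<^sup>2\<close>, so concavity of the square root applies.
\<close>

lemma norm_segment_lower_bound:
  fixes x y :: "'a::real_inner"
  assumes "0 \<le> t" "t \<le> 1" "x \<noteq> 0" "y \<noteq> 0"
  defines "k \<equiv> ((norm x + norm y)\<^sup>2 - (norm (x - y))\<^sup>2) / (4 * norm x * norm y)"
  shows "k * ((1 - t) * norm x + t * norm y) + (1 - k) * \<bar>(1 - t) * norm x - t * norm y\<bar>
    \<le> norm (x + t *\<^sub>R (y - x))"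
proof (rule power2_le_imp_le)
  let ?A = "(1 - t) * norm x + t * norm y" and ?B = "\<bar>(1 - t) * norm x - t * norm y\<bar>"
  have pos: "norm x > 0" "norm y > 0" using assms by auto
  have k': "k * (4 * norm x * norm y) = (norm x + norm y)\<^sup>2 - (norm (x - y))\<^sup>2"
    using pos by (simp add: k_def)
  have nxy: "(norm (x - y))\<^sup>2 = (norm x)\<^sup>2 + (norm y)\<^sup>2 - 2 * (x \<bullet> y)"
    by (simp add: power2_norm_eq_inner inner_diff_left inner_diff_right inner_commute)
  \<comment> \<open>So \<open>k\<close> is (1 + cos) / 2 for the angle between \<open>x\<close> and
    \<open>y\<close>. The triangle inequality gives \<open>0 \<le> k\<close>, Cauchy-Schwarz gives
    \<open>k \<le> 1\<close>.\<close>
  have xy: "x \<bullet> y = (2 * k - 1) * (norm x * norm y)"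
    using k' unfolding nxy by (simp add: power2_eq_square algebra_simps)
  have "norm (x - y) \<le> norm x + norm y" by (rule norm_triangle_ineq4)
  then have "(norm (x - y))\<^sup>2 \<le> (norm x + norm y)\<^sup>2" by (rule power_mono) simp
  then have k0: "0 \<le> k" using pos by (simp add: k_def)
  have "x \<bullet> y \<le> norm x * norm y" by (rule norm_cauchy_schwarz)
  then have k1: "k \<le> 1" using pos unfolding xy by simp
  have "(norm (x + t *\<^sub>R (y - x)))\<^sup>2 =
      (1 - t)\<^sup>2 * (norm x)\<^sup>2 + t\<^sup>2 * (norm y)\<^sup>2 + 2 * t * (1 - t) * (x \<bullet> y)"
    unfolding power2_norm_eq_inner by (simp add: inner_simps inner_commute algebra_simps power2_eq_square)
  also have "\<dots> = k * ?A\<^sup>2 + (1 - k) * ?B\<^sup>2"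
    unfolding xy power2_abs by (simp add: algebra_simps power2_eq_square)
  \<comment> \<open>The mean of the squares is the square of the mean plus a variance, which is
    nonnegative.\<close>
  also have "\<dots> = (k * ?A + (1 - k) * ?B)\<^sup>2 + k * (1 - k) * (?A - ?B)\<^sup>2"
    by (simp add: algebra_simps power2_eq_square)
  finally show "(k * ?A + (1 - k) * ?B)\<^sup>2 \<le> (norm (x + t *\<^sub>R (y - x)))\<^sup>2"
    using k0 k1 by simp
qed simp

text \<open>
  A lower bound for the mean distance from a vertex of a triangle to the points of the opposite side
  \<open>w\<close>, where \<open>u\<close> and \<open>v\<close> are the sides meeting in the vertex.
\<close>

definition vertex_side_bound :: "real \<Rightarrow> real \<Rightarrow> real \<Rightarrow> real" where
  "vertex_side_bound u v w = (u + v) / 2 - (w\<^sup>2 - (u - v)\<^sup>2) / (4 * (u + v))"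

lemma vertex_side_bound_commute: "vertex_side_bound u v w = vertex_side_bound v u w"
  by (simp add: vertex_side_bound_def power2_commute add.commute)

text \<open>The pointwise bound is integrated. With u and v for the norms of \<open>x\<close> and
  \<open>y\<close>, the two terms have means (u + v) / 2 and (u^2 + v^2) / (2 (u + v)); inserting
  \<open>k\<close> gives \<open>vertex_side_bound\<close>.\<close>

lemma mean_norm_segment_lower_bound:
  fixes x y :: "'a::euclidean_space"
  assumes "x \<noteq> 0" "y \<noteq> 0"
  shows "vertex_side_bound (norm x) (norm y) (norm (x - y))
    \<le> integral {0..1} (\<lambda>t. norm (x + t *\<^sub>R (y - x)))"
proof -
  define k where "k = ((norm x + norm y)\<^sup>2 - (norm (x - y))\<^sup>2) / (4 * norm x * norm y)"
  have pos: "norm x > 0" "norm y > 0" using assms by auto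
  have "((\<lambda>t. (1 - t) * norm x + t * norm y) has_integral
      (norm x + (norm y - norm x) / 2) - 0) {0..1}"
  proof -
    have "((\<lambda>t. t * norm x + t\<^sup>2 * (norm y - norm x) / 2) has_vector_derivative
        (1 - t) * norm x + t * norm y) (at t within {0..1})" for t
      unfolding has_real_derivative_iff_has_vector_derivative[symmetric]
      by (auto intro!: derivative_eq_intros simp: field_simps)
    from fundamental_theorem_of_calculus[OF _ this] show ?thesis by simp
  qed
  then have "((\<lambda>t. k * ((1 - t) * norm x + t * norm y) + (1 - k) * \<bar>(1 - t) * norm x - t * norm y\<bar>)
    has_integral k * ((norm x + (norm y - norm x) / 2) - 0) +
      (1 - k) * (((norm x)\<^sup>2 + (norm y)\<^sup>2) / (2 * (norm x + norm y)))) {0..1}"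
    using pos by (intro has_integral_add has_integral_mult_right has_integral_abs_affine add_pos_pos) auto
  moreover have "((\<lambda>t. norm (x + t *\<^sub>R (y - x))) has_integral
      integral {0..1} (\<lambda>t. norm (x + t *\<^sub>R (y - x)))) {0..1}"
    by (intro integrable_integral integrable_continuous_real continuous_intros)
  ultimately have "k * ((norm x + (norm y - norm x) / 2) - 0) +
      (1 - k) * (((norm x)\<^sup>2 + (norm y)\<^sup>2) / (2 * (norm x + norm y)))
      \<le> integral {0..1} (\<lambda>t. norm (x + t *\<^sub>R (y - x)))"
    using norm_segment_lower_bound[OF _ _ assms] unfolding k_def by (rule has_integral_le) auto
  moreover have "k * ((norm x + (norm y - norm x) / 2) - 0) +
      (1 - k) * (((norm x)\<^sup>2 + (norm y)\<^sup>2) / (2 * (norm x + norm y))) =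
      vertex_side_bound (norm x) (norm y) (norm (x - y))"
  proof -
    define n where "n = (norm (x - y))\<^sup>2"
    have "norm x + norm y \<noteq> 0" using pos by linarith
    then show ?thesis
      using pos unfolding k_def vertex_side_bound_def n_def[symmetric]
      by (simp add: divide_simps) (simp add: algebra_simps power2_eq_square)
  qed
  ultimately show ?thesis by simp
qed

section \<open>Pairs of points on two segments with a common endpoint\<close>

lemma integral_triangle_swap:
  fixes f :: "real \<Rightarrow> real \<Rightarrow> real"
  assumes f: "continuous_on UNIV (\<lambda>(s, t). f s t)"
  shows "integral {0..1} (\<lambda>s. integral {s..1} (f s)) = integral {0..1} (\<lambda>t. integral {0..t} (\<lambda>s. f s t))"
    and "(\<lambda>s. integral {s..1} (f s)) integrable_on {0..1}"
proof -
  \<comment> \<open>Extension by zero off the compact triangle 0 <= s <= t <= 1, on which the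
    continuous \<open>f\<close> is integrable. Fubini for \<open>F\<close> yields both
    claims.\<close>
  define F where "F = (\<lambda>(s, t). indicator {(s, t). 0 \<le> s \<and> s \<le> t \<and> t \<le> 1} (s, t) *\<^sub>R f s t)"
  have c1: "continuous_on A (f s)" for A s
    using continuous_on_compose2[OF f continuous_on_Pair[OF continuous_on_const continuous_on_id]] by simp
  have c2: "continuous_on A (\<lambda>s. f s t)" for A t
    using continuous_on_compose2[OF f continuous_on_Pair[OF continuous_on_id continuous_on_const]] by simp
  have "closed {(s::real, t::real). 0 \<le> s \<and> s \<le> t \<and> t \<le> 1}"
    unfolding case_prod_beta by (intro closed_Collect_conj closed_Collect_le continuous_intros)
  moreover have "bounded {(s::real, t::real). 0 \<le> s \<and> s \<le> t \<and> t \<le> 1}"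
    by (rule bounded_subset[OF bounded_cbox[of "(0,0)" "(1,1)"]]) (auto simp: cbox_Pair_eq)
  ultimately have "set_integrable lborel {(s::real, t::real). 0 \<le> s \<and> s \<le> t \<and> t \<le> 1} (\<lambda>(s, t). f s t)"
    unfolding set_integrable_def
    by (intro borel_integrable_compact continuous_on_subset[OF f]) (auto simp: compact_eq_bounded_closed)
  then have int: "integrable (lborel \<Otimes>\<^sub>M lborel) F"
    unfolding set_integrable_def lborel_prod F_def by (simp add: case_prod_beta')
  have 1: "(LINT t|lborel. F (s, t)) = indicator {0..1} s *\<^sub>R integral {s..1} (f s)" for s
  proof (cases "s \<in> {0..1}")
    case True
    have "(LINT t|lborel. F (s, t)) = (LINT t:{s..1}|lborel. f s t)"
      using True unfolding set_lebesgue_integral_def F_def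
      by (intro Bochner_Integration.integral_cong) (auto simp: indicator_def)
    also have "\<dots> = integral {s..1} (f s)"
      by (intro set_borel_integral_eq_integral borel_integrable_atLeastAtMost' c1)
    finally show ?thesis using True by simp
  next
    case False
    then have "F (s, t) = 0" for t by (auto simp: F_def indicator_def)
    then show ?thesis using False by simp
  qed
  have 2: "(LINT s|lborel. F (s, t)) = indicator {0..1} t *\<^sub>R integral {0..t} (\<lambda>s. f s t)" for t
  proof (cases "t \<in> {0..1}")
    case True
    have "(LINT s|lborel. F (s, t)) = (LINT s:{0..t}|lborel. f s t)"
      using True unfolding set_lebesgue_integral_def F_def
      by (intro Bochner_Integration.integral_cong) (auto simp: indicator_def)
    also have "\<dots> = integral {0..t} (\<lambda>s. f s t)"
      by (intro set_borel_integral_eq_integral borel_integrable_atLeastAtMost' c2)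
    finally show ?thesis using True by simp
  next
    case False
    then have "F (s, t) = 0" for s by (auto simp: F_def indicator_def)
    then show ?thesis using False by simp
  qed
  have i1: "set_integrable lborel {0..1} (\<lambda>s. integral {s..1} (f s))"
    using lborel_pair.integrable_fst'[OF int] unfolding set_integrable_def 1 .
  have i2: "set_integrable lborel {0..1} (\<lambda>t. integral {0..t} (\<lambda>s. f s t))"
    using lborel_pair.integrable_snd[of "\<lambda>s t. F (s, t)"] int unfolding set_integrable_def 2 by simp
  have "(LINT t|lborel. LINT s|lborel. F (s, t)) = (LINT s|lborel. LINT t|lborel. F (s, t))"
    using lborel_pair.Fubini_integral[of "\<lambda>s t. F (s, t)"] int by simp
  then show "integral {0..1} (\<lambda>s. integral {s..1} (f s)) = integral {0..1} (\<lambda>t. integral {0..t} (\<lambda>s. f s t))"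
    using set_borel_integral_eq_integral(2)[OF i1] set_borel_integral_eq_integral(2)[OF i2]
    unfolding 1 2 set_lebesgue_integral_def by simp
  show "(\<lambda>s. integral {s..1} (f s)) integrable_on {0..1}"
    using set_borel_integral_eq_integral(1)[OF i1] .
qed

text \<open>The substitution of \<open>s * t\<close> for \<open>t\<close> gives one factor
  \<open>s\<close>, homogeneity of the norm the other.\<close>

lemma integral_norm_scale:
  fixes v w :: "'a::euclidean_space"
  assumes "0 \<le> s"
  shows "integral {0..s} (\<lambda>t. norm (s *\<^sub>R v - t *\<^sub>R w)) = s\<^sup>2 * integral {0..1} (\<lambda>t. norm (v - t *\<^sub>R w))"
proof (cases "s = 0")
  case False
  then have s: "s > 0" using assms by simp
  have "((\<lambda>t. norm (v - t *\<^sub>R w)) has_integral integral {0..1} (\<lambda>t. norm (v - t *\<^sub>R w))) {0..1}"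
    by (intro integrable_integral integrable_continuous_real continuous_intros)
  from has_integral_affinity[of _ _ 0 1 "1/s" 0, OF this[unfolded interval_cbox]]
  have "((\<lambda>t. norm (v - (t / s) *\<^sub>R w)) has_integral s * integral {0..1} (\<lambda>t. norm (v - t *\<^sub>R w))) {0..s}"
    using s by (simp add: image_mult_atLeastAtMost)
  then have "((\<lambda>t. s * norm (v - (t / s) *\<^sub>R w)) has_integral s * (s * integral {0..1} (\<lambda>t. norm (v - t *\<^sub>R w)))) {0..s}"
    by (rule has_integral_mult_right)
  moreover have "s * norm (v - (t / s) *\<^sub>R w) = norm (s *\<^sub>R v - t *\<^sub>R w)" for t
  proof -
    have "s * norm (v - (t / s) *\<^sub>R w) = norm (s *\<^sub>R (v - (t / s) *\<^sub>R w))" using s by simp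
    also have "s *\<^sub>R (v - (t / s) *\<^sub>R w) = s *\<^sub>R v - t *\<^sub>R w"
      using s by (simp add: scaleR_diff_right)
    finally show ?thesis .
  qed
  ultimately show ?thesis
    by (simp add: integral_unique power2_eq_square mult.assoc)
qed simp

text \<open>
  Splitting the unit square along the diagonal and rescaling the smaller parameter by the larger one
  reduces the double integral to distances from an endpoint.
\<close>

lemma mean_distance_adjacent_segments:
  fixes v w :: "'a::euclidean_space"
  shows "integral {0..1} (\<lambda>s. integral {0..1} (\<lambda>t. norm (s *\<^sub>R v - t *\<^sub>R w))) =
    (integral {0..1} (\<lambda>t. norm (v - t *\<^sub>R w)) + integral {0..1} (\<lambda>t. norm (w - t *\<^sub>R v))) / 3"
proof -
  let ?f = "\<lambda>s t. norm (s *\<^sub>R v - t *\<^sub>R w)"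
  \<comment> \<open>Rescaling produces the weight \<open>s\<^sup>2\<close>; its integral is the
    source of the division by 3.\<close>
  have cube: "((\<lambda>s::real. s\<^sup>2 * K) has_integral K / 3) {0..1}" for K
  proof -
    have "((\<lambda>s. s ^ 3 * K / 3) has_vector_derivative s\<^sup>2 * K) (at s within {0..1})" for s :: real
      unfolding has_real_derivative_iff_has_vector_derivative[symmetric]
      by (auto intro!: derivative_eq_intros)
    from fundamental_theorem_of_calculus[OF _ this] show ?thesis by simp
  qed
  have c: "continuous_on UNIV (\<lambda>(s, t). ?f s t)"
    unfolding case_prod_beta by (intro continuous_intros)
  have "integral {0..1} (\<lambda>s. integral {0..1} (?f s)) =
      integral {0..1} (\<lambda>s. integral {0..s} (?f s) + integral {s..1} (?f s))"
    by (intro Henstock_Kurzweil_Integration.integral_cong Henstock_Kurzweil_Integration.integral_combine[symmetric]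
        integrable_continuous_real continuous_intros) auto
  also have "\<dots> = integral {0..1} (\<lambda>s. s\<^sup>2 * integral {0..1} (\<lambda>t. norm (v - t *\<^sub>R w)) + integral {s..1} (?f s))"
    by (intro Henstock_Kurzweil_Integration.integral_cong) (simp add: integral_norm_scale)
  also have "\<dots> = integral {0..1} (\<lambda>t. norm (v - t *\<^sub>R w)) / 3 + integral {0..1} (\<lambda>s. integral {s..1} (?f s))"
    using Henstock_Kurzweil_Integration.integral_add[OF has_integral_integrable[OF cube] integral_triangle_swap(2)[OF c]]
    by (simp only: integral_unique[OF cube])
  also have "integral {0..1} (\<lambda>s. integral {s..1} (?f s)) = integral {0..1} (\<lambda>t. integral {0..t} (\<lambda>s. ?f s t))"
    by (rule integral_triangle_swap(1)[OF c])
  also have "\<dots> = integral {0..1} (\<lambda>t. t\<^sup>2 * integral {0..1} (\<lambda>s. norm (w - s *\<^sub>R v)))"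
    by (intro Henstock_Kurzweil_Integration.integral_cong)
      (simp add: integral_norm_scale[symmetric] norm_minus_commute)
  also have "\<dots> = integral {0..1} (\<lambda>s. norm (w - s *\<^sub>R v)) / 3"
    using cube by (rule integral_unique)
  finally show ?thesis by (simp add: add_divide_distrib)
qed

section \<open>Double integrals of the distance over two sides\<close>

lemma segment_integral_commute:
  assumes "continuous_on UNIV f"
  shows "segment_integral p q f = segment_integral q p f"
proof -
  have "continuous_on {0..1} (\<lambda>t. f (p + t *\<^sub>R (q - p)))"
    by (intro continuous_on_compose2[OF assms] continuous_intros) auto
  then have "((\<lambda>t. f (p + t *\<^sub>R (q - p))) has_integral integral {0..1} (\<lambda>t. f (p + t *\<^sub>R (q - p)))) {0..1}"
    by (intro integrable_integral integrable_continuous_real)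
  from has_integral_affinity[of _ _ 0 1 "-1" 1, OF this[unfolded interval_cbox]]
  have "((\<lambda>t. f (p + (1 - t) *\<^sub>R (q - p))) has_integral integral {0..1} (\<lambda>t. f (p + t *\<^sub>R (q - p)))) {0..1}"
    by simp
  moreover have "p + (1 - t) *\<^sub>R (q - p) = q + t *\<^sub>R (p - q)" for t
    by (simp add: algebra_simps)
  ultimately show ?thesis
    by (simp add: segment_integral_def integral_unique dist_commute)
qed

lemma segment_integral_add:
  assumes "continuous_on UNIV f" "continuous_on UNIV g"
  shows "segment_integral p q (\<lambda>x. f x + g x) = segment_integral p q f + segment_integral p q g"
proof -
  have "(\<lambda>t. h (p + t *\<^sub>R (q - p))) integrable_on {0..1}" if "continuous_on UNIV h" for h :: "'a \<Rightarrow> real"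
    by (intro integrable_continuous_real continuous_on_compose2[OF that] continuous_intros) auto
  with assms show ?thesis
    by (simp add: segment_integral_def Henstock_Kurzweil_Integration.integral_add distrib_left)
qed

text \<open>This function is the inner integral of a double integral, and the formula for integrals
  over the boundary is stated for continuous integrands.\<close>

lemma continuous_on_segment_integral_dist: "continuous_on UNIV (\<lambda>x. segment_integral p q (dist x))"
proof -
  have "continuous_on UNIV (\<lambda>x. integral (cbox 0 1) (\<lambda>t. dist x (p + t *\<^sub>R (q - p))))"
    by (intro integral_continuous_on_param) (auto simp: case_prod_beta intro!: continuous_intros)
  then show ?thesis
    unfolding segment_integral_def interval_cbox by (intro continuous_on_mult continuous_on_const)
qed

text \<open>Each of the two integrations and the distance itself contribute a factor
  \<open>dist p q\<close>; 1/3 is the mean of |s - t| on the unit square.\<close>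

lemma segment_integral_dist_same:
  "segment_integral p q (\<lambda>x. segment_integral p q (dist x)) = dist p q ^ 3 / 3"
proof -
  have inner: "integral {0..1} (\<lambda>t. dist (p + s *\<^sub>R (q - p)) (p + t *\<^sub>R (q - p))) = dist p q * ((s\<^sup>2 + (1 - s)\<^sup>2) / 2)"
    if s: "s \<in> {0..1}" for s
  proof -
    have "dist (p + s *\<^sub>R (q - p)) (p + t *\<^sub>R (q - p)) = dist p q * \<bar>(1 - t) * s - t * (1 - s)\<bar>" for t
    proof -
      have "(p + s *\<^sub>R (q - p)) - (p + t *\<^sub>R (q - p)) = (s - t) *\<^sub>R (q - p)"
        by (simp add: algebra_simps)
      then have "dist (p + s *\<^sub>R (q - p)) (p + t *\<^sub>R (q - p)) = \<bar>s - t\<bar> * norm (q - p)"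
        by (simp only: dist_norm norm_scaleR)
      \<comment> \<open>The shape of \<open>has_integral_abs_affine\<close> with coefficients
        \<open>s\<close> and \<open>1 - s\<close>, whose sum is 1.\<close>
      also have "s - t = (1 - t) * s - t * (1 - s)" by algebra
      finally show ?thesis by (simp add: dist_norm norm_minus_commute)
    qed
    moreover have "((\<lambda>t. dist p q * \<bar>(1 - t) * s - t * (1 - s)\<bar>) has_integral
        dist p q * ((s\<^sup>2 + (1 - s)\<^sup>2) / (2 * (s + (1 - s))))) {0..1}"
      using s by (intro has_integral_mult_right has_integral_abs_affine) auto
    ultimately have "integral {0..1} (\<lambda>t. dist (p + s *\<^sub>R (q - p)) (p + t *\<^sub>R (q - p))) =
        dist p q * ((s\<^sup>2 + (1 - s)\<^sup>2) / (2 * (s + (1 - s))))"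
      by (simp only: integral_unique)
    then show ?thesis by simp
  qed
  have "((\<lambda>s::real. (s\<^sup>2 + (1 - s)\<^sup>2) / 2) has_integral (1 ^ 3 - (1 - 1) ^ 3) / 6 - (0 ^ 3 - (1 - 0) ^ 3) / 6) {0..1}"
  proof (rule fundamental_theorem_of_calculus)
    show "((\<lambda>s. (s ^ 3 - (1 - s) ^ 3) / 6) has_vector_derivative (s\<^sup>2 + (1 - s)\<^sup>2) / 2) (at s within {0..1})"
      for s :: real
      unfolding has_real_derivative_iff_has_vector_derivative[symmetric]
      by (auto intro!: derivative_eq_intros)
  qed simp
  then have outer: "integral {0..1} (\<lambda>s::real. (s\<^sup>2 + (1 - s)\<^sup>2) / 2) = 1 / 3"
    by (simp only: integral_unique) simp
  have "integral {0..1} (\<lambda>s. segment_integral p q (dist (p + s *\<^sub>R (q - p)))) =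
      integral {0..1} (\<lambda>s. dist p q * (dist p q * ((s\<^sup>2 + (1 - s)\<^sup>2) / 2)))"
    unfolding segment_integral_def
    by (intro Henstock_Kurzweil_Integration.integral_cong) (simp only: inner)
  also have "\<dots> = dist p q * (dist p q * (1 / 3))"
    by (simp only: integral_mult_right outer)
  finally show ?thesis
    unfolding segment_integral_def[of p q "\<lambda>x. segment_integral p q (dist x)"]
    by (simp add: power3_eq_cube)
qed

text \<open>The two summands bound the mean distances from \<open>q\<close> to the side
  \<open>p r\<close> and from \<open>r\<close> to the side \<open>p q\<close>, which
  \<open>mean_distance_adjacent_segments\<close> combines.\<close>

lemma segment_integral_dist_adjacent:
  fixes p q r :: "'a::euclidean_space"
  assumes "p \<noteq> q" "q \<noteq> r" "r \<noteq> p"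
  shows "segment_integral p q (\<lambda>x. segment_integral p r (dist x)) \<ge>
    dist p q * dist r p * (vertex_side_bound (dist p q) (dist q r) (dist r p) +
      vertex_side_bound (dist r p) (dist q r) (dist p q)) / 3"
proof -
  have e: "dist (p + s *\<^sub>R (q - p)) (p + t *\<^sub>R (r - p)) = norm (s *\<^sub>R (q - p) - t *\<^sub>R (r - p))" for s t
    by (simp add: dist_norm)
  have flip: "u + t *\<^sub>R (v - w) = u - t *\<^sub>R (w - v)" for u v w :: 'a and t
    by (simp add: algebra_simps)
  have "vertex_side_bound (norm (q - p)) (norm (q - r)) (norm (r - p))
    \<le> integral {0..1} (\<lambda>t. norm ((q - p) - t *\<^sub>R (r - p)))"
    using mean_norm_segment_lower_bound[of "q - p" "q - r"] assms
    by (simp add: norm_minus_commute flip)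
  moreover have "vertex_side_bound (norm (r - p)) (norm (r - q)) (norm (q - p))
    \<le> integral {0..1} (\<lambda>t. norm ((r - p) - t *\<^sub>R (q - p)))"
    using mean_norm_segment_lower_bound[of "r - p" "r - q"] assms
    by (simp add: norm_minus_commute flip)
  ultimately have "(vertex_side_bound (dist p q) (dist q r) (dist r p) +
      vertex_side_bound (dist r p) (dist q r) (dist p q)) / 3
     \<le> integral {0..1} (\<lambda>s. integral {0..1} (\<lambda>t. norm (s *\<^sub>R (q - p) - t *\<^sub>R (r - p))))"
    unfolding mean_distance_adjacent_segments by (simp add: dist_norm norm_minus_commute)
  then have "dist p q * dist r p * ((vertex_side_bound (dist p q) (dist q r) (dist r p) +
      vertex_side_bound (dist r p) (dist q r) (dist p q)) / 3)
     \<le> dist p q * dist r p * integral {0..1} (\<lambda>s. integral {0..1} (\<lambda>t. norm (s *\<^sub>R (q - p) - t *\<^sub>R (r - p))))"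
    by (intro mult_left_mono) auto
  then show ?thesis
    unfolding segment_integral_def e by (simp add: dist_commute mult.assoc)
qed

section \<open>Mean distance of interior points\<close>

text \<open>If \<open>q\<close> and \<open>r\<close> have the same sign, then |p| = |q| + |r|, and
  the vector is a combination of \<open>b - a\<close> and \<open>c - a\<close> with coefficients
  \<open>q\<close> and \<open>r\<close>. The triangle inequality then gives exactly the right-hand
  side, because any two of its coefficients add up to the side joining the two vertices. The other
  cases are cyclic.\<close>

lemma norm_barycentric_le:
  fixes a b c :: "'a::real_normed_vector"
  assumes "p + q + r = (0::real)"
  shows "norm (p *\<^sub>R a + q *\<^sub>R b + r *\<^sub>R c) \<le>
    (dist a b + dist c a - dist b c) / 2 * \<bar>p\<bar> + (dist a b + dist b c - dist c a) / 2 * \<bar>q\<bar> +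
    (dist b c + dist c a - dist a b) / 2 * \<bar>r\<bar>"
proof -
  have *: "norm (p *\<^sub>R a + q *\<^sub>R b + r *\<^sub>R c) \<le>
      (dist a b + dist c a - dist b c) / 2 * \<bar>p\<bar> + (dist a b + dist b c - dist c a) / 2 * \<bar>q\<bar> +
      (dist b c + dist c a - dist a b) / 2 * \<bar>r\<bar>"
    if "p + q + r = 0" "0 \<le> q * r" for p q r :: real and a b c :: 'a
  proof -
    have p: "p = - (q + r)" using that by simp
    have "p *\<^sub>R a + q *\<^sub>R b + r *\<^sub>R c = q *\<^sub>R (b - a) + r *\<^sub>R (c - a)"
      unfolding p by (simp add: algebra_simps)
    also have "norm \<dots> \<le> norm (q *\<^sub>R (b - a)) + norm (r *\<^sub>R (c - a))"
      by (rule norm_triangle_ineq)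
    finally have "norm (p *\<^sub>R a + q *\<^sub>R b + r *\<^sub>R c) \<le> \<bar>q\<bar> * dist a b + \<bar>r\<bar> * dist c a"
      by (simp add: dist_norm norm_minus_commute)
    moreover have "\<bar>p\<bar> = \<bar>q\<bar> + \<bar>r\<bar>"
      using that by (auto simp: zero_le_mult_iff)
    then have "(dist a b + dist c a - dist b c) / 2 * \<bar>p\<bar> + (dist a b + dist b c - dist c a) / 2 * \<bar>q\<bar> +
      (dist b c + dist c a - dist a b) / 2 * \<bar>r\<bar> = \<bar>q\<bar> * dist a b + \<bar>r\<bar> * dist c a"
      by (simp add: field_simps)
    ultimately show ?thesis by simp
  qed
  \<comment> \<open>two of the three coefficients have the same sign\<close>
  consider "0 \<le> q * r" | "0 \<le> r * p" | "0 \<le> p * q"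
    by (metis linorder_le_cases mult_nonneg_nonneg mult_nonpos_nonpos)
  then show ?thesis
  proof cases
    case 1
    then show ?thesis using *[of p q r a b c] assms by simp
  next
    case 2
    then show ?thesis using *[of q r p b c a] assms by (simp add: algebra_simps)
  next
    case 3
    then show ?thesis using *[of r p q c a b] assms by (simp add: algebra_simps)
  qed
qed

section \<open>Mean absolute difference of a barycentric coordinate\<close>

lemma barycentric_coordinate_exists:
  fixes a b c :: "'a::real_inner"
  assumes "\<not> collinear {a, b, c}"
  shows "\<exists>n d. n \<bullet> a + d = 1 \<and> n \<bullet> b + d = 0 \<and> n \<bullet> c + d = 0"
proof -
  define u w where "u = c - b" and "w = a - b"
  \<comment> \<open>The component of \<open>a - b\<close> orthogonal to the side \<open>b c\<close>,
    nonzero as the points are not collinear. Suitably scaled, it is the gradient of the barycentric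
    coordinate of \<open>a\<close>.\<close>
  define n where "n = w - ((w \<bullet> u) / (u \<bullet> u)) *\<^sub>R u"
  have nc: "\<not> collinear {0, u, w}"
    using assms collinear_3[of a b c] unfolding u_def w_def by (simp add: insert_commute)
  then have "u \<noteq> 0" "n \<noteq> 0"
    by (auto simp: collinear_lemma n_def)
  have nu: "n \<bullet> u = 0"
    using \<open>u \<noteq> 0\<close> by (simp add: n_def inner_diff_left)
  have "n \<bullet> n = n \<bullet> w"
    using nu by (subst (2) n_def) (simp add: inner_diff_right)
  moreover have "n \<bullet> n \<noteq> 0" using \<open>n \<noteq> 0\<close> by simp
  ultimately have "(n /\<^sub>R (n \<bullet> n)) \<bullet> w = 1" "(n /\<^sub>R (n \<bullet> n)) \<bullet> u = 0"
    using nu by auto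
  then show ?thesis
    unfolding u_def w_def
    by (intro exI[of _ "n /\<^sub>R (n \<bullet> n)"] exI[of _ "- ((n /\<^sub>R (n \<bullet> n)) \<bullet> b)"])
      (simp only: inner_diff_right; simp)
qed

text \<open>The integrand is 1 if the threshold \<open>t\<close> separates \<open>p\<close> from
  \<open>q\<close>, and 0 otherwise.\<close>

lemma nn_integral_layer_cake_abs_diff:
  fixes p q :: real
  assumes "p \<in> {0..1}" "q \<in> {0..1}"
  shows "(\<integral>\<^sup>+t. ennreal \<bar>of_bool (t \<le> p) - of_bool (t \<le> q)\<bar> * indicator {0..1} t \<partial>lborel) = ennreal \<bar>p - q\<bar>"
proof -
  have "(\<integral>\<^sup>+t. ennreal \<bar>of_bool (t \<le> p) - of_bool (t \<le> q)\<bar> * indicator {0..1} t \<partial>lborel) =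
      (\<integral>\<^sup>+t. indicator {min p q<..max p q} t \<partial>lborel)"
    using assms by (intro nn_integral_cong) (auto simp: indicator_def min_def max_def of_bool_def)
  also have "\<dots> = ennreal (max p q - min p q)"
    by simp
  also have "max p q - min p q = \<bar>p - q\<bar>" by auto
  finally show ?thesis .
qed

text \<open>By Tonelli the expectation moves inside the integral over thresholds. Two independent
  copies are separated by \<open>t\<close> with probability 2 P (1 - P), where P is the probability
  of \<open>t \<le> X x\<close>.\<close>

lemma (in prob_space) nn_integral_abs_diff:
  fixes X :: "'a \<Rightarrow> real"
  assumes [measurable]: "X \<in> borel_measurable M" and X: "AE x in M. X x \<in> {0..1}"
  shows "(\<integral>\<^sup>+x. \<integral>\<^sup>+y. ennreal \<bar>X x - X y\<bar> \<partial>M \<partial>M) =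
    (\<integral>\<^sup>+t. ennreal (2 * prob {x \<in> space M. t \<le> X x} * (1 - prob {x \<in> space M. t \<le> X x})) *
      indicator {0..1} t \<partial>lborel)"
proof -
  interpret pair_sigma_finite M lborel ..
  define H where "H x y t = ennreal \<bar>of_bool (t \<le> X x) - of_bool (t \<le> X y)\<bar>" for x y t
  have [measurable]: "Measurable.pred (M \<Otimes>\<^sub>M lborel) (\<lambda>z. snd z \<le> X (fst z))"
    by measurable
  have HE: "(\<integral>\<^sup>+x. \<integral>\<^sup>+y. H x y t \<partial>M \<partial>M) =
      ennreal (2 * prob {x \<in> space M. t \<le> X x} * (1 - prob {x \<in> space M. t \<le> X x}))" for t
  proof -
    define E where "E = {x \<in> space M. t \<le> X x}"
    have [measurable]: "E \<in> sets M" unfolding E_def by measurable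
    have "emeasure M (space M - E) = ennreal (1 - prob E)"
      by (simp add: emeasure_eq_measure prob_compl)
    moreover have "(\<integral>\<^sup>+x. \<integral>\<^sup>+y. H x y t \<partial>M \<partial>M) =
        (\<integral>\<^sup>+x. \<integral>\<^sup>+y. indicator E x * indicator (space M - E) y + indicator (space M - E) x * indicator E y \<partial>M \<partial>M)"
      by (intro nn_integral_cong) (auto simp: H_def E_def indicator_def)
    moreover have "\<dots> = (\<integral>\<^sup>+x. indicator E x * emeasure M (space M - E) + indicator (space M - E) x * emeasure M E \<partial>M)"
      by (simp add: nn_integral_add nn_integral_cmult)
    moreover have "\<dots> = emeasure M E * emeasure M (space M - E) + emeasure M (space M - E) * emeasure M E"
      by (simp add: nn_integral_add nn_integral_multc)
    moreover have "\<dots> = ennreal (prob E * (1 - prob E) + (1 - prob E) * prob E)"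
      by (simp only: calculation(1) emeasure_eq_measure[of E] ennreal_plus ennreal_mult
          mult_nonneg_nonneg measure_nonneg diff_ge_0_iff_ge prob_le_1)
    moreover have "prob E * (1 - prob E) + (1 - prob E) * prob E = 2 * prob E * (1 - prob E)"
      by algebra
    ultimately show ?thesis
      by (simp only: E_def[symmetric])
  qed
  have "(\<integral>\<^sup>+x. \<integral>\<^sup>+y. ennreal \<bar>X x - X y\<bar> \<partial>M \<partial>M) =
      (\<integral>\<^sup>+x. \<integral>\<^sup>+y. \<integral>\<^sup>+t. H x y t * indicator {0..1} t \<partial>lborel \<partial>M \<partial>M)"
  proof (rule nn_integral_cong_AE, use X in eventually_elim)
    case (elim x)
    show ?case
      by (rule nn_integral_cong_AE, use X in eventually_elim)
        (simp only: H_def nn_integral_layer_cake_abs_diff[OF elim])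
  qed
  also have "\<dots> = (\<integral>\<^sup>+x. \<integral>\<^sup>+t. \<integral>\<^sup>+y. H x y t * indicator {0..1} t \<partial>M \<partial>lborel \<partial>M)"
    unfolding H_def by (intro nn_integral_cong Fubini'[symmetric]) measurable
  also have "\<dots> = (\<integral>\<^sup>+t. \<integral>\<^sup>+x. \<integral>\<^sup>+y. H x y t * indicator {0..1} t \<partial>M \<partial>M \<partial>lborel)"
    unfolding H_def by (intro Fubini'[symmetric]) measurable
  also have "\<dots> = (\<integral>\<^sup>+t. (\<integral>\<^sup>+x. \<integral>\<^sup>+y. H x y t \<partial>M \<partial>M) * indicator {0..1} t \<partial>lborel)"
    unfolding H_def by (simp add: nn_integral_multc)
  finally show ?thesis unfolding HE .
qed

text \<open>For barycentric coordinates u, v, w with u >= t, the numbers (u - t) / (1 - t), v / (1 -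
  t), w / (1 - t) are again barycentric coordinates. The part near \<open>a\<close> is thus a
  homothetic copy of the triangle with ratio 1 - t, and in the plane its area has the factor (1 -
  t)^2.\<close>

lemma superlevel_barycentric_coordinate:
  fixes a b c n :: "'a::real_inner"
  assumes n: "n \<bullet> a + d = 1" "n \<bullet> b + d = 0" "n \<bullet> c + d = 0" and t: "0 \<le> t" "t < 1"
  shows "convex hull {a, b, c} \<inter> {x. t \<le> n \<bullet> x + d} = (\<lambda>x. (1 - t) *\<^sub>R x + t *\<^sub>R a) ` (convex hull {a, b, c})"
proof (intro set_eqI iffI)
  fix x assume "x \<in> convex hull {a, b, c} \<inter> {x. t \<le> n \<bullet> x + d}"
  then obtain u v w where uvw: "0 \<le> u" "0 \<le> v" "0 \<le> w" "u + v + w = 1"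
    and x: "x = u *\<^sub>R a + v *\<^sub>R b + w *\<^sub>R c" and tx: "t \<le> n \<bullet> x + d"
    unfolding convex_hull_3 by auto
  \<comment> \<open>The last summand is zero; with it the identity holds for arbitrary
    \<open>u\<close>, \<open>v\<close>, \<open>w\<close> and is pure algebra.\<close>
  have "n \<bullet> x + d = u * (n \<bullet> a + d) + v * (n \<bullet> b + d) + w * (n \<bullet> c + d) + (1 - (u + v + w)) * d"
    unfolding x by (simp add: inner_add_right algebra_simps)
  then have "t \<le> u" using tx n uvw by simp
  define y where "y = ((u - t) / (1 - t)) *\<^sub>R a + (v / (1 - t)) *\<^sub>R b + (w / (1 - t)) *\<^sub>R c"
  have "(u - t) / (1 - t) + v / (1 - t) + w / (1 - t) = 1"
    using uvw t by (simp add: add_divide_distrib[symmetric])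
  then have "y \<in> convex hull {a, b, c}"
    unfolding convex_hull_3 y_def using uvw t \<open>t \<le> u\<close>
    by (intro CollectI exI[of _ "(u - t) / (1 - t)"] exI[of _ "v / (1 - t)"] exI[of _ "w / (1 - t)"]) auto
  moreover have "x = (1 - t) *\<^sub>R y + t *\<^sub>R a"
    using t unfolding x y_def by (simp add: scaleR_add_right scaleR_diff_left)
  ultimately show "x \<in> (\<lambda>x. (1 - t) *\<^sub>R x + t *\<^sub>R a) ` (convex hull {a, b, c})" by blast
next
  fix x assume "x \<in> (\<lambda>x. (1 - t) *\<^sub>R x + t *\<^sub>R a) ` (convex hull {a, b, c})"
  then obtain y where y: "y \<in> convex hull {a, b, c}" and x: "x = (1 - t) *\<^sub>R y + t *\<^sub>R a" by blast
  obtain u v w where uvw: "0 \<le> u" "0 \<le> v" "0 \<le> w" "u + v + w = 1"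
    and y': "y = u *\<^sub>R a + v *\<^sub>R b + w *\<^sub>R c"
    using y unfolding convex_hull_3 by auto
  have "n \<bullet> y + d = u * (n \<bullet> a + d) + v * (n \<bullet> b + d) + w * (n \<bullet> c + d) + (1 - (u + v + w)) * d"
    unfolding y' by (simp add: inner_add_right algebra_simps)
  then have "n \<bullet> y + d \<ge> 0" using n uvw by simp
  moreover have "n \<bullet> x + d = (1 - t) * (n \<bullet> y + d) + t * (n \<bullet> a + d)"
    unfolding x by (simp add: inner_add_right algebra_simps)
  ultimately have "t \<le> n \<bullet> x + d" using n t by simp
  moreover have "x \<in> convex hull {a, b, c}"
    unfolding x using t y by (intro convexD[OF convex_convex_hull]) (auto intro: hull_inc)
  ultimately show "x \<in> convex hull {a, b, c} \<inter> {x. t \<le> n \<bullet> x + d}" by simp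
qed

text \<open>The centroid is an interior point, so the area is positive; compactness makes it
  finite.\<close>

lemma emeasure_triangle:
  fixes a b c :: "real^2"
  assumes "\<not> collinear {a, b, c}"
  shows "emeasure lborel (convex hull {a, b, c}) \<noteq> 0" "emeasure lborel (convex hull {a, b, c}) \<noteq> \<infinity>"
proof -
  let ?K = "convex hull {a, b, c}"
  have "(1/3) *\<^sub>R a + (1/3) *\<^sub>R b + (1/3) *\<^sub>R c \<in> interior ?K"
  proof -
    have "DIM(real^2) = 2" by simp
    show ?thesis
      unfolding interior_convex_hull_3_minimal[OF assms \<open>DIM(real^2) = 2\<close>]
      by (intro CollectI exI[of _ "1/3"]) simp
  qed
  then have "\<not> negligible ?K"
    using negligible_convex_interior[of ?K] by auto
  then show "emeasure lborel ?K \<noteq> 0"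
    by (simp add: negligible_iff_null_sets null_sets_def borel_compact compact_convex_hull)
  show "emeasure lborel ?K \<noteq> \<infinity>"
    using emeasure_compact_finite[of ?K] by (simp add: compact_convex_hull less_top[symmetric])
qed

lemma nn_integral_abs_diff_barycentric_coordinate:
  fixes a b c n :: "real^2"
  assumes nc: "\<not> collinear {a, b, c}"
    and n: "n \<bullet> a + d = 1" "n \<bullet> b + d = 0" "n \<bullet> c + d = 0"
  defines "U \<equiv> uniform_measure lborel (convex hull {a, b, c})"
  shows "(\<integral>\<^sup>+x. \<integral>\<^sup>+y. ennreal \<bar>(n \<bullet> x + d) - (n \<bullet> y + d)\<bar> \<partial>U \<partial>U) = ennreal (4 / 15)"
proof -
  let ?K = "convex hull {a, b, c}" and ?X = "\<lambda>x. n \<bullet> x + d"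
  note K = emeasure_triangle[OF nc]
  have Kb: "?K \<in> sets borel" by (simp add: borel_compact compact_convex_hull)
  interpret U: prob_space U
    unfolding U_def by (rule prob_space_uniform_measure[OF K])
  have [measurable]: "?X \<in> borel_measurable U"
    unfolding U_def by measurable
  have range: "?X x \<in> {0..1}" if x: "x \<in> ?K" for x
  proof -
    obtain u v w where uvw: "0 \<le> u" "0 \<le> v" "0 \<le> w" "u + v + w = 1"
      and x: "x = u *\<^sub>R a + v *\<^sub>R b + w *\<^sub>R c"
      using x unfolding convex_hull_3 by auto
    have "?X x = u * (n \<bullet> a + d) + v * (n \<bullet> b + d) + w * (n \<bullet> c + d) + (1 - (u + v + w)) * d"
      unfolding x by (simp add: inner_add_right algebra_simps)
    then show ?thesis using n uvw by simp
  qed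
  have AE: "AE x in U. ?X x \<in> {0..1}"
    unfolding U_def using Kb range by (intro AE_uniform_measureI AE_I2) auto
  have prob: "U.prob {x \<in> space U. t \<le> ?X x} = (1 - t)\<^sup>2" if t: "0 \<le> t" "t < 1" for t
  proof -
    have m: "{x. t \<le> ?X x} \<in> sets borel" by measurable
    have "measure lborel (?K \<inter> {x. t \<le> ?X x}) = measure lebesgue (?K \<inter> {x. t \<le> ?X x})"
      using Kb m by (simp add: measure_completion)
    also have "\<dots> = (1 - t)\<^sup>2 * measure lebesgue ?K"
      unfolding superlevel_barycentric_coordinate[OF n t] using t by (subst measure_lebesgue_affine) simp
    also have "measure lebesgue ?K = measure lborel ?K"
      using Kb by (simp add: measure_completion)
    finally have "measure lborel (?K \<inter> {x. t \<le> ?X x}) = (1 - t)\<^sup>2 * measure lborel ?K" .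
    moreover have "measure lborel ?K \<noteq> 0"
      using K by (simp add: measure_def enn2real_eq_0_iff)
    ultimately show ?thesis
      using K m by (simp add: U_def)
  qed
  have "(\<integral>\<^sup>+x. \<integral>\<^sup>+y. ennreal \<bar>?X x - ?X y\<bar> \<partial>U \<partial>U) =
    (\<integral>\<^sup>+t. ennreal (2 * U.prob {x \<in> space U. t \<le> ?X x} * (1 - U.prob {x \<in> space U. t \<le> ?X x})) *
      indicator {0..1} t \<partial>lborel)"
    by (intro U.nn_integral_abs_diff AE) measurable
  also have "\<dots> = (\<integral>\<^sup>+t. ennreal (2 * (1 - t)\<^sup>2 * (1 - (1 - t)\<^sup>2)) * indicator {0..1} t \<partial>lborel)"
  \<comment> \<open>The formula for the probability excludes \<open>t = 1\<close>, a null
    set.\<close>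
  proof (rule nn_integral_cong_AE, use AE_lborel_singleton[of 1] in eventually_elim)
    case (elim t)
    then show ?case using prob[of t] by (auto simp: indicator_def)
  qed
  \<comment> \<open>The antiderivative is written in powers of \<open>1 - t\<close>; its increment
    is 2/3 - 2/5.\<close>
  also have "\<dots> = ennreal (- 2 * (1 - 1) ^ 3 / 3 + 2 * (1 - 1) ^ 5 / 5 - (- 2 * (1 - 0) ^ 3 / 3 + 2 * (1 - 0) ^ 5 / 5))"
  proof (rule nn_integral_FTC_Icc)
    show "((\<lambda>t::real. - 2 * (1 - t) ^ 3 / 3 + 2 * (1 - t) ^ 5 / 5) has_real_derivative
        2 * (1 - t)\<^sup>2 * (1 - (1 - t)\<^sup>2)) (at t)" for t
      by (auto intro!: derivative_eq_intros simp: field_simps power_numeral_reduce)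
    show "0 \<le> 2 * (1 - t)\<^sup>2 * (1 - (1 - t)\<^sup>2)" if "t \<in> {0..1}" for t :: real
      using that by (simp add: power_le_one)
  qed auto
  finally show ?thesis by simp
qed

section \<open>Upper bound for \<open>Delta\<close>\<close>

lemma Delta_triangle_le:
  fixes a b c :: "real^2"
  assumes nc: "\<not> collinear {a, b, c}"
  shows "Delta (convex hull {a, b, c}) \<le> 2 / 15 * (dist a b + dist b c + dist c a)"
proof -
  let ?K = "convex hull {a, b, c}"
  define U where "U = uniform_measure lborel ?K"
  note K = emeasure_triangle[OF nc]
  have Kb: "?K \<in> sets borel" by (simp add: borel_compact compact_convex_hull)
  interpret U: prob_space U
    unfolding U_def by (rule prob_space_uniform_measure[OF K])
  have sU[measurable_cong]: "sets U = sets borel" by (simp add: U_def)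
  have AE: "AE x in U. x \<in> ?K"
    unfolding U_def using Kb by (intro AE_uniform_measureI AE_I2) auto
  \<comment> \<open>The coefficients of \<open>norm_barycentric_le\<close>, nonnegative by the
    triangle inequality; geometrically, the tangent lengths from the vertices to the
    incircle.\<close>
  define ka kb kc where "ka = (dist a b + dist c a - dist b c) / 2"
    and "kb = (dist a b + dist b c - dist c a) / 2" and "kc = (dist b c + dist c a - dist a b) / 2"
  have k: "0 \<le> ka" "0 \<le> kb" "0 \<le> kc"
    unfolding ka_def kb_def kc_def
    using dist_triangle2[of b c a] dist_triangle2[of a c b] dist_triangle2[of a b c]
    by (simp_all add: dist_commute)
  obtain na da where A: "na \<bullet> a + da = 1" "na \<bullet> b + da = 0" "na \<bullet> c + da = 0"
    using barycentric_coordinate_exists[OF nc] by blast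
  have nc': "\<not> collinear {b, c, a}" "\<not> collinear {c, a, b}"
    using nc by (simp_all add: insert_commute)
  obtain nb db where B: "nb \<bullet> b + db = 1" "nb \<bullet> c + db = 0" "nb \<bullet> a + db = 0"
    using barycentric_coordinate_exists[OF nc'(1)] by blast
  obtain nc dc where C: "nc \<bullet> c + dc = 1" "nc \<bullet> a + dc = 0" "nc \<bullet> b + dc = 0"
    using barycentric_coordinate_exists[OF nc'(2)] by blast
  let ?A = "\<lambda>x. na \<bullet> x + da" and ?B = "\<lambda>x. nb \<bullet> x + db" and ?C = "\<lambda>x. nc \<bullet> x + dc"
  have coord: "x = ?A x *\<^sub>R a + ?B x *\<^sub>R b + ?C x *\<^sub>R c \<and> ?A x + ?B x + ?C x = 1" if x: "x \<in> ?K" for x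
  proof -
    obtain u v w where uvw: "u + v + w = 1" and x: "x = u *\<^sub>R a + v *\<^sub>R b + w *\<^sub>R c"
      using x unfolding convex_hull_3 by auto
    have e: "n \<bullet> x + d = u * (n \<bullet> a + d) + v * (n \<bullet> b + d) + w * (n \<bullet> c + d) + (1 - (u + v + w)) * d" for n d
      unfolding x by (simp add: inner_add_right algebra_simps)
    have "?A x = u" "?B x = v" "?C x = w"
      unfolding e A B C uvw by simp_all
    then show ?thesis using x uvw by simp
  qed
  have ptw: "dist x y \<le> ka * \<bar>?A x - ?A y\<bar> + kb * \<bar>?B x - ?B y\<bar> + kc * \<bar>?C x - ?C y\<bar>"
    if "x \<in> ?K" "y \<in> ?K" for x y
  proof -
    have "x - y = (?A x *\<^sub>R a + ?B x *\<^sub>R b + ?C x *\<^sub>R c) - (?A y *\<^sub>R a + ?B y *\<^sub>R b + ?C y *\<^sub>R c)"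
      using coord[OF that(1)] coord[OF that(2)] by metis
    also have "\<dots> = (?A x - ?A y) *\<^sub>R a + (?B x - ?B y) *\<^sub>R b + (?C x - ?C y) *\<^sub>R c"
      by (simp add: algebra_simps)
    finally have "dist x y = norm ((?A x - ?A y) *\<^sub>R a + (?B x - ?B y) *\<^sub>R b + (?C x - ?C y) *\<^sub>R c)"
      by (simp only: dist_norm)
    \<comment> \<open>The coordinates of each point sum to 1, so their differences sum to 0.\<close>
    also have "\<dots> \<le> ka * \<bar>?A x - ?A y\<bar> + kb * \<bar>?B x - ?B y\<bar> + kc * \<bar>?C x - ?C y\<bar>"
      unfolding ka_def kb_def kc_def
      by (rule norm_barycentric_le) (use coord[OF that(1)] coord[OF that(2)] in linarith)
    finally show ?thesis .
  qed
  have int: "(\<integral>\<^sup>+x. \<integral>\<^sup>+y. ennreal \<bar>?A x - ?A y\<bar> \<partial>U \<partial>U) = ennreal (4 / 15)"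
    "(\<integral>\<^sup>+x. \<integral>\<^sup>+y. ennreal \<bar>?B x - ?B y\<bar> \<partial>U \<partial>U) = ennreal (4 / 15)"
    "(\<integral>\<^sup>+x. \<integral>\<^sup>+y. ennreal \<bar>?C x - ?C y\<bar> \<partial>U \<partial>U) = ennreal (4 / 15)"
    using nn_integral_abs_diff_barycentric_coordinate[OF assms A]
      nn_integral_abs_diff_barycentric_coordinate[OF nc'(1) B]
      nn_integral_abs_diff_barycentric_coordinate[OF nc'(2) C]
    unfolding U_def by (simp_all only: insert_commute)
  have "(\<integral>\<^sup>+p. ennreal (dist (fst p) (snd p)) \<partial>(U \<Otimes>\<^sub>M U)) = (\<integral>\<^sup>+x. \<integral>\<^sup>+y. ennreal (dist x y) \<partial>U \<partial>U)"
    by (subst U.nn_integral_fst[symmetric]) simp_all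
  also have "\<dots> \<le> (\<integral>\<^sup>+x. \<integral>\<^sup>+y. ennreal ka * ennreal \<bar>?A x - ?A y\<bar> + ennreal kb * ennreal \<bar>?B x - ?B y\<bar>
      + ennreal kc * ennreal \<bar>?C x - ?C y\<bar> \<partial>U \<partial>U)"
  proof (rule nn_integral_mono_AE, use AE in eventually_elim)
    case (elim x)
    show ?case
    proof (rule nn_integral_mono_AE, use AE in eventually_elim)
      case (elim y)
      show ?case
        using ptw[OF \<open>x \<in> ?K\<close> elim] k
        by (simp add: ennreal_mult[symmetric] ennreal_plus[symmetric] ennreal_leI del: ennreal_plus)
    qed
  qed
  also have "\<dots> = ennreal ka * (\<integral>\<^sup>+x. \<integral>\<^sup>+y. ennreal \<bar>?A x - ?A y\<bar> \<partial>U \<partial>U) +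
      ennreal kb * (\<integral>\<^sup>+x. \<integral>\<^sup>+y. ennreal \<bar>?B x - ?B y\<bar> \<partial>U \<partial>U) +
      ennreal kc * (\<integral>\<^sup>+x. \<integral>\<^sup>+y. ennreal \<bar>?C x - ?C y\<bar> \<partial>U \<partial>U)"
    by (simp add: nn_integral_add nn_integral_cmult)
  also have "\<dots> = ennreal (ka * (4 / 15) + kb * (4 / 15) + kc * (4 / 15))"
    unfolding int using k by (simp add: ennreal_mult[symmetric] ennreal_plus[symmetric] del: ennreal_plus)
  also have "ka * (4 / 15) + kb * (4 / 15) + kc * (4 / 15) = 2 / 15 * (dist a b + dist b c + dist c a)"
    by (simp add: ka_def kb_def kc_def field_simps)
  finally have le: "(\<integral>\<^sup>+p. ennreal (dist (fst p) (snd p)) \<partial>(U \<Otimes>\<^sub>M U)) \<le>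
      ennreal (2 / 15 * (dist a b + dist b c + dist c a))" .
  have "Delta ?K = enn2real (\<integral>\<^sup>+p. ennreal (dist (fst p) (snd p)) \<partial>(U \<Otimes>\<^sub>M U))"
    unfolding Delta_def mean_distance_def U_def[symmetric] by (intro integral_eq_nn_integral) auto
  also have "\<dots> \<le> 2 / 15 * (dist a b + dist b c + dist c a)"
    using le by (intro enn2real_leI) auto
  finally show ?thesis .
qed

section \<open>Comparison with the perimeter\<close>

text \<open>\<open>A\<close> has the denominator \<open>y + z\<close> and the total weight
  \<open>x * (y + z)\<close>, and similarly for \<open>B\<close> and \<open>C\<close>. Grouping by
  vertices therefore clears all denominators and leaves a polynomial identity.\<close>

lemma vertex_side_bound_sum:
  fixes x y z :: real
  assumes "0 < x" "0 < y" "0 < z"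
  defines "A \<equiv> vertex_side_bound y z x" and "B \<equiv> vertex_side_bound z x y" and "C \<equiv> vertex_side_bound x y z"
  shows "x ^ 3 / 3 + y ^ 3 / 3 + z ^ 3 / 3 +
    2 * (x * y * (A + B) / 3 + y * z * (B + C) / 3 + z * x * (C + A) / 3) = (x + y + z) ^ 3 / 6"
proof -
  have m: "vertex_side_bound u v w * (u + v) = (u + v)\<^sup>2 / 2 - (w\<^sup>2 - (u - v)\<^sup>2) / 4" if "0 < u" "0 < v" for u v w
    using that unfolding vertex_side_bound_def by (simp add: divide_simps) (simp add: algebra_simps power2_eq_square)
  have "x * y * (A + B) / 3 + y * z * (B + C) / 3 + z * x * (C + A) / 3 =
      (x * (A * (y + z)) + y * (B * (z + x)) + z * (C * (x + y))) / 3"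
    by (simp add: field_simps)
  also have "\<dots> = (x * ((y + z)\<^sup>2 / 2 - (x\<^sup>2 - (y - z)\<^sup>2) / 4) + y * ((z + x)\<^sup>2 / 2 - (y\<^sup>2 - (z - x)\<^sup>2) / 4) +
      z * ((x + y)\<^sup>2 / 2 - (z\<^sup>2 - (x - y)\<^sup>2) / 4)) / 3"
    unfolding A_def B_def C_def using assms(1-3) by (simp only: m)
  finally show ?thesis
    by (simp only:) (simp add: field_simps power2_eq_square power3_eq_cube)
qed

text \<open>The double integral of the distance over the boundary splits into nine ordered pairs of
  sides. Their lower bounds add up to L^3 / 6 by \<open>vertex_side_bound_sum\<close>, and
  normalization divides by L^2.\<close>

lemma theta_triangle_ge:
  fixes a b c :: "real^2"
  assumes nc: "\<not> collinear {a, b, c}"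
  defines "K \<equiv> convex hull {a, b, c}" and "L \<equiv> dist a b + dist b c + dist c a"
  shows "perimeter K = L" and "L / 6 \<le> theta K"
proof -
  define F where "F = frontier K"
  define \<mu> where "\<mu> = arc_length F"
  have F: "F = closed_segment a b \<union> closed_segment b c \<union> closed_segment c a"
    unfolding F_def K_def by (simp add: frontier_of_triangle Un_assoc)
  have "triangle K" unfolding triangle_def K_def using nc by blast
  then have g: "jordan_param (SOME g. jordan_param g F) F"
    unfolding F_def by (rule someI_ex[OF jordan_param_triangle])
  note path = path_arc_length_triangle[OF nc g[unfolded F], folded F, folded arc_length_def, folded \<mu>_def]
  interpret \<mu>: finite_measure \<mu> by (rule path(1))
  have sets\<mu>[measurable_cong]: "sets \<mu> = sets borel" and space\<mu>: "space \<mu> = UNIV"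
    by (simp_all add: \<mu>_def arc_length_def path_arc_length_def)
  have neq: "a \<noteq> b" "b \<noteq> c" "c \<noteq> a"
    using nc by (auto simp: insert_commute)
  have L: "L > 0" unfolding L_def using neq by (simp add: add_pos_pos)
  have Fb: "F \<in> sets borel" unfolding F by (intro borel_closed closed_Un closed_segment)
  have "(LINT x|\<mu>. 1) = L"
    using path(3)[of "\<lambda>_. 1"] by (simp add: segment_integral_def L_def)
  then have \<mu>UNIV: "measure \<mu> UNIV = L" by (simp add: space\<mu>)
  have "measure \<mu> F = measure \<mu> UNIV"
    using path(2) Fb by (intro \<mu>.finite_measure_eq_AE) auto
  then have \<mu>F: "measure \<mu> F = L" using \<mu>UNIV by simp
  then show "perimeter K = L"
    by (simp add: perimeter_def F_def \<mu>_def)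
  have e\<mu>F: "emeasure \<mu> F = ennreal L" using \<mu>F by (simp add: \<mu>.emeasure_eq_measure)
  define U where "U = uniform_measure \<mu> F"
  \<comment> \<open>As \<open>\<mu>\<close> is concentrated on \<open>F\<close>, conditioning on
    \<open>F\<close> only normalizes the mass.\<close>
  have U: "U = density \<mu> (\<lambda>_. ennreal (1 / L))"
    unfolding U_def uniform_measure_def
  proof (rule density_cong)
    show "AE x in \<mu>. indicator F x / emeasure \<mu> F = ennreal (1 / L)"
      using path(2) by eventually_elim (use L in \<open>simp add: e\<mu>F divide_ennreal[symmetric]\<close>)
  qed (use Fb in auto)
  interpret U: prob_space U
    unfolding U_def using e\<mu>F L by (intro prob_space_uniform_measure) auto
  interpret UU: pair_sigma_finite U U ..
  interpret UU': finite_measure "U \<Otimes>\<^sub>M U"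
    by (rule finite_measure_pair_measure) unfold_locales
  have setsU[measurable_cong]: "sets U = sets borel" and spaceU: "space U = UNIV"
    by (simp_all add: U_def sets\<mu> space\<mu>)
  have intU: "integral\<^sup>L U f = integral\<^sup>L \<mu> f / L" if "continuous_on UNIV f" for f :: "real^2 \<Rightarrow> real"
  proof -
    have [measurable]: "f \<in> borel_measurable borel" using that by (rule borel_measurable_continuous_onI)
    show ?thesis unfolding U using L by (subst integral_density) simp_all
  qed
  have AEU: "AE x in U. x \<in> F"
    unfolding U_def using Fb by (intro AE_uniform_measureI AE_I2) (auto simp: sets\<mu>)
  have "bounded F" unfolding F by (auto simp: bounded_closed_segment)
  \<comment> \<open>Fubini requires integrability; the distance is bounded almost everywhere by the
    diameter, and the measure is finite.\<close>
  have "AE p in U \<Otimes>\<^sub>M U. norm (dist (fst p) (snd p)) \<le> diameter F"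
  proof (rule UU.AE_pair_measure)
    show "AE x in U. AE y in U. norm (dist (fst (x, y)) (snd (x, y))) \<le> diameter F"
      using AEU
    proof eventually_elim
      case (elim x)
      show ?case
        using AEU by eventually_elim (use \<open>bounded F\<close> \<open>x \<in> F\<close> in \<open>simp add: diameter_bounded_bound\<close>)
    qed
  qed measurable
  then have int: "integrable (U \<Otimes>\<^sub>M U) (\<lambda>p. dist (fst p) (snd p))"
    by (rule UU'.integrable_const_bound) measurable
  let ?S = "\<lambda>p q r s. segment_integral p q (\<lambda>x. segment_integral r s (dist x))"
  let ?W = "\<lambda>x. segment_integral a b (dist x) + segment_integral b c (dist x) + segment_integral c a (dist x)"
  have cW: "continuous_on UNIV ?W"
    by (intro continuous_on_add continuous_on_segment_integral_dist)
  have W: "(LINT y|U. dist x y) = ?W x / L" for x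
  proof -
    have "continuous_on UNIV (dist x)" by (intro continuous_intros)
    then show ?thesis using intU[of "dist x"] path(3)[of "dist x"] by simp
  qed
  have "theta K = (LINT p|(U \<Otimes>\<^sub>M U). dist (fst p) (snd p))"
    by (simp add: theta_def mean_distance_def U_def F_def \<mu>_def)
  also have "\<dots> = (LINT x|U. LINT y|U. dist x y)"
    using UU.integral_fst'[OF int] by simp
  also have "\<dots> = (LINT x|U. ?W x) / L"
    unfolding W by simp
  also have "\<dots> = (LINT x|\<mu>. ?W x) / L\<^sup>2"
    using intU[OF cW] by (simp add: power2_eq_square)
  finally have theta: "theta K = (LINT x|\<mu>. ?W x) / L\<^sup>2" .
  have seg: "segment_integral p q ?W = ?S p q a b + ?S p q b c + ?S p q c a" for p q
    by (simp add: segment_integral_add continuous_on_add continuous_on_segment_integral_dist)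
  \<comment> \<open>Reversing either segment lets both start at their common vertex, as in
    \<open>segment_integral_dist_adjacent\<close>.\<close>
  have swap: "?S p q r s = ?S q p r s" "?S p q r s = ?S p q s r" for p q r s :: "real^2"
  proof -
    show "?S p q r s = ?S q p r s"
      by (intro segment_integral_commute continuous_on_segment_integral_dist)
    have "segment_integral r s (dist x) = segment_integral s r (dist x)" for x
      by (intro segment_integral_commute continuous_intros)
    then show "?S p q r s = ?S p q s r" by simp
  qed
  \<comment> \<open>\<open>x\<close>, \<open>y\<close>, \<open>z\<close> are the sides opposite
    \<open>a\<close>, \<open>b\<close>, \<open>c\<close>, and \<open>A\<close>, \<open>B\<close>,
    \<open>C\<close> bound the mean distances from these vertices to them.\<close>
  define x y z where "x = dist b c" and "y = dist c a" and "z = dist a b"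
  define A B C where "A = vertex_side_bound y z x" and "B = vertex_side_bound z x y" and "C = vertex_side_bound x y z"
  have D: "dist b c = x" "dist c b = x" "dist c a = y" "dist a c = y" "dist a b = z" "dist b a = z"
    by (simp_all add: x_def y_def z_def dist_commute)
  have M: "vertex_side_bound y z x = A" "vertex_side_bound z y x = A" "vertex_side_bound z x y = B"
    "vertex_side_bound x z y = B" "vertex_side_bound x y z = C" "vertex_side_bound y x z = C"
    by (simp_all add: A_def B_def C_def vertex_side_bound_commute)
  have "L ^ 3 / 6 = x ^ 3 / 3 + y ^ 3 / 3 + z ^ 3 / 3 +
      2 * (x * y * (A + B) / 3 + y * z * (B + C) / 3 + z * x * (C + A) / 3)"
    unfolding A_def B_def C_def L_def using neq
    by (subst vertex_side_bound_sum) (simp_all add: x_def y_def z_def ac_simps)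
  \<comment> \<open>Each side with itself, then each pair of different sides in both orders.\<close>
  also have "\<dots> \<le> ?S a b a b + ?S b c b c + ?S c a c a + (?S a b b c + ?S b c a b) +
      (?S b c c a + ?S c a b c) + (?S c a a b + ?S a b c a)"
  proof -
    have adj: "dist p q * dist r p * (vertex_side_bound (dist p q) (dist q r) (dist r p) +
        vertex_side_bound (dist r p) (dist q r) (dist p q)) / 3 \<le> ?S p q p r"
      if "p \<noteq> q" "q \<noteq> r" "r \<noteq> p" for p q r :: "real^2"
      using segment_integral_dist_adjacent[OF that] .
    have "2 * (z * x * (C + A) / 3) \<le> ?S a b b c + ?S b c a b"
    proof -
      have "z * x * (C + A) / 3 \<le> ?S a b b c" "z * x * (C + A) / 3 \<le> ?S b c a b"
        using adj[of b a c] adj[of b c a] neq swap[of a b b c] swap[of b c a b]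
        by (simp_all add: D M algebra_simps)
      then show ?thesis by linarith
    qed
    moreover have "2 * (x * y * (A + B) / 3) \<le> ?S b c c a + ?S c a b c"
    proof -
      have "x * y * (A + B) / 3 \<le> ?S b c c a" "x * y * (A + B) / 3 \<le> ?S c a b c"
        using adj[of c b a] adj[of c a b] neq swap[of b c c a] swap[of c a b c]
        by (simp_all add: D M algebra_simps)
      then show ?thesis by linarith
    qed
    moreover have "2 * (y * z * (B + C) / 3) \<le> ?S c a a b + ?S a b c a"
    proof -
      have "y * z * (B + C) / 3 \<le> ?S c a a b" "y * z * (B + C) / 3 \<le> ?S a b c a"
        using adj[of a c b] adj[of a b c] neq swap[of c a a b] swap[of a b c a]
        by (simp_all add: D M algebra_simps)
      then show ?thesis by linarith
    qed
    ultimately show ?thesis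
      unfolding segment_integral_dist_same D distrib_left by linarith
  qed
  also have "\<dots> = (LINT x|\<mu>. ?W x)"
    unfolding path(3)[OF cW] seg by simp
  finally have "L ^ 3 / 6 \<le> (LINT x|\<mu>. ?W x)" .
  then have "L ^ 3 / 6 / L\<^sup>2 \<le> theta K"
    unfolding theta by (intro divide_right_mono) auto
  moreover have "L ^ 3 / 6 / L\<^sup>2 = L / 6"
    using L by (simp add: power2_eq_square power3_eq_cube)
  ultimately show "L / 6 \<le> theta K" by simp
qed

theorem mainTheorem12:
  fixes K :: "(real^2) set"
  assumes "triangle K"
  shows "theta K - Delta K \<ge> 7 / 240 * perimeter K"
proof -
  obtain a b c where nc: "\<not> collinear {a, b, c}" and K: "K = convex hull {a, b, c}"
    using assms unfolding triangle_def by blast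
  define L where "L = dist a b + dist b c + dist c a"
  have "perimeter K = L" "L / 6 \<le> theta K" "Delta K \<le> 2 / 15 * L"
    using theta_triangle_ge[OF nc] Delta_triangle_le[OF nc] unfolding K L_def by simp_all
  \<comment> \<open>1/6 - 2/15 = 1/30 = 8/240, so a nonnegative \<open>L\<close> gives the constant
    7/240.\<close>
  moreover have "0 \<le> L" by (simp add: L_def)
  ultimately show ?thesis by simp
qed

end
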